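(* Let $\rho$ and $\sigma$ be states in $M_n$, and let $\bot_n=\frac1n I_n$ denote the completely mixed state on $M_n$. The following are true for the QPE order $\sqsubseteq$: 1. The completely mixed state is the bottom element: $\bot_n\sqsubseteq\rho$ for any state $\rho$. 2. The pure states are maximal. A pure state $|v\rangle\langle v|$ is above $\rho$ (that is, $\rho\sqsubseteq|v\rangle\langle v|$) if and only if $v\in L^+(\rho)$. 3. The order is invariant under unitary conjugation: $\rho\sqsubseteq\sigma$ if and only if $U\rho U^\dagger\sqsubseteq U\sigma U^\dagger$ for any unitary operator $U\in U(n)$. In fact, the order is invariant under application of any linear (trace preserving) isometry $\Phi:M_n\to M_k$. 4. When $\rho\sqsubseteq\sigma$ we have $\ker(\rho)\subseteq\ker(\sigma)$ and $\operatorname{rank}(\rho)\ge\operatorname{rank}(\sigma)$. 5. The convex structure of the state space is preserved: $\rho\sqsubseteq\sigma$ if and only if $\rho\sqsubseteq(1-t)\rho+t\sigma\sqsubseteq\sigma$ for all $0\le t\le 1$. 6. Downsets $\{\rho\in DO(n):\rho\sqsubseteq\sigma\}$ are closed convex spaces. Uppersets $\{\sigma\in DO(n):\rho\sqsubseteq\sigma\}$ are also closed and are unions of closed convex spaces. (The QPE order is actually an example of a pospace: the graph induced by the order is closed in $DO(n)\times DO(n)$.) 7. Let $\rho_i,\sigma_i\in DO(n_i)$ with $\rho_i\sqsubseteq\sigma_i$ for $i=1,2$. Then $\rho_1\otimes\rho_2\sqsubseteq\sigma_1\otimes\sigma_2$. 8. When $\rho\sqsubseteq\sigma$ we have $\lambda(\rho)\sqsubseteq\lambda(\sigma)$,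 where $\lambda(\rho)$ denotes the ordered eigenvalues of $\rho$.
   Context: $M_n$ denotes the complex $n\times n$ matrices. A state is an element of $DO(n)=\{A\in M_n : A\ge 0,\ \operatorname{tr}A=1\}$ (with its usual topology as a subset of $M_n$), where $A\ge0$ means positive semidefinite and $A\le B$ means $B-A\ge 0$. For a positive semidefinite matrix $A$, $A^+$ is its highest eigenvalue (equal to the operator norm $\|A\|$), and $L^+(A)=\{v : Av=A^+v\}$ is the corresponding eigenspace. A pure state is a state $|v\rangle\langle v|$ with $v$ a unit vector. The QPE (quantum positive evidence) order on $DO(n)$ is the relation $$\rho\sqsubseteq\sigma \iff \frac{\sigma}{\sigma^+}\le\frac{\rho}{\rho^+}\iff \sigma^+\rho-\rho^+\sigma\ge 0 .$$ In item 3, isometry refers to the operator norm, $\|\Phi(A)\|=\|A\|$, and invariance under $\Phi$ means that $\rho\sqsubseteq\sigma$ if and only if $\Phi(\rho)\sqsubseteq\Phi(\sigma)$. In item 8, the eigenvalues are counted with multiplicity and listed in decreasing order, and for probability vectors $x,y$ of length $n$, $x\sqsubseteq y$ means $y_i/y^+\le x_i/x^+$ for all $i$, with $x^+=\max_i x_i$ (the QPE order on diagonal states).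
   Formalization: In item 3, the linear trace preserving isometry Φ is additionally assumed to map states to states; otherwise Φ(ρ) need not be a state and invariance fails, e.g. for Φ(A) = A ⊕ diag(a_11, −a_11) from M_2 to M_4. *)

theory Defs
  imports "HOL-Analysis.Analysis" "HOL-Computational_Algebra.Polynomial" "HOL-Library.Multiset"
begin

definition dagger :: "complex^'n^'m \<Rightarrow> complex^'m^'n" where
  "dagger A = map_matrix cnj (transpose A)"

definition unitary_mat :: "complex^'n^'n \<Rightarrow> bool" where
  "unitary_mat U \<longleftrightarrow> dagger U ** U = mat 1 \<and> U ** dagger U = mat 1"

(* The library offers only real scaling on complex matrices;
   its *s would need a scalar of type complex^'n here. *)
definition cscale :: "complex \<Rightarrow> complex^'n^'m \<Rightarrow> complex^'n^'m" where
  "cscale c = map_matrix ((*) c)"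

(* The inner product is conjugate-linear in its first argument. *)
definition cinner_vec :: "complex^'n \<Rightarrow> complex^'n \<Rightarrow> complex" where
  "cinner_vec v w = (\<Sum>i\<in>UNIV. cnj (v $ i) * w $ i)"

definition psd :: "complex^'n^'n \<Rightarrow> bool" where
  "psd A \<longleftrightarrow> dagger A = A \<and> (\<forall>v. 0 \<le> Re (cinner_vec v (A *v v)))"

(* The library's order on vectors and matrices is the componentwise one. *)
definition loewner_le :: "complex^'n^'n \<Rightarrow> complex^'n^'n \<Rightarrow> bool"  (infix \<open>\<preceq>\<^sub>L\<close> 50) where
  "A \<preceq>\<^sub>L B \<longleftrightarrow> psd (B - A)"

definition states :: "(complex^'n^'n) set" where
  "states = {A. psd A \<and> trace A = 1}"

definition eigenvalue :: "complex^'n^'n \<Rightarrow> complex \<Rightarrow> bool" where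
  "eigenvalue A l \<longleftrightarrow> (\<exists>v. v \<noteq> 0 \<and> A *v v = l *s v)"

(* Intended for positive semidefinite matrices, whose eigenvalues are all real. *)
definition top_eigenvalue :: "complex^'n^'n \<Rightarrow> real" where
  "top_eigenvalue A = Max {r. eigenvalue A (complex_of_real r)}"

definition top_eigenspace :: "complex^'n^'n \<Rightarrow> (complex^'n) set" where
  "top_eigenspace A = {v. A *v v = complex_of_real (top_eigenvalue A) *s v}"

definition op_norm :: "complex^'n^'m \<Rightarrow> real" where
  "op_norm A = onorm (\<lambda>v. A *v v)"

definition ketbra :: "complex^'n \<Rightarrow> complex^'n^'n" where
  "ketbra v = (\<chi> i j. v $ i * cnj (v $ j))"

definition completely_mixed :: "complex^'n^'n" where
  "completely_mixed = (1 / real CARD('n)) *\<^sub>R mat 1"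

(* A relation on states: it carries membership of both sides. *)
definition qpe :: "complex^'n^'n \<Rightarrow> complex^'n^'n \<Rightarrow> bool"  (infix \<open>\<sqsubseteq>\<^sub>Q\<close> 50) where
  "\<rho> \<sqsubseteq>\<^sub>Q \<sigma> \<longleftrightarrow> \<rho> \<in> states \<and> \<sigma> \<in> states \<and>
     (1 / top_eigenvalue \<sigma>) *\<^sub>R \<sigma> \<preceq>\<^sub>L (1 / top_eigenvalue \<rho>) *\<^sub>R \<rho>"

definition qpe_maximal :: "complex^'n^'n \<Rightarrow> bool" where
  "qpe_maximal \<rho> \<longleftrightarrow> \<rho> \<in> states \<and> (\<forall>\<tau>\<in>states. \<rho> \<sqsubseteq>\<^sub>Q \<tau> \<longrightarrow> \<tau> = \<rho>)"

definition mat_ker :: "complex^'n^'m \<Rightarrow> (complex^'n) set" where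
  "mat_ker A = {v. A *v v = 0}"

definition tensor :: "complex^'a^'a \<Rightarrow> complex^'b^'b \<Rightarrow> complex^('a \<times> 'b)^('a \<times> 'b)"
    (infixl \<open>\<otimes>\<^sub>Q\<close> 70) where
  "A \<otimes>\<^sub>Q B = (\<chi> i j. A $ fst i $ fst j * B $ snd i $ snd j)"

definition pospace_on :: "'a::topological_space set \<Rightarrow> 'a rel \<Rightarrow> bool" where
  "pospace_on S r \<longleftrightarrow> partial_order_on S r \<and> closedin (top_of_set (S \<times> S)) r"

definition charpoly :: "complex^'n^'n \<Rightarrow> complex poly" where
  "charpoly A = det (mat [:0, 1:] - map_matrix (\<lambda>a. [:a:]) A)"

(* Decreasing list of the eigenvalues with multiplicity; like the top eigenvalue,
   meant for matrices with real spectrum, where Re discards nothing. *)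
definition ordered_eigenvalues :: "complex^'n^'n \<Rightarrow> real list" where
  "ordered_eigenvalues A = rev (sorted_list_of_multiset (image_mset Re (proots (charpoly A))))"

definition prob_vectors :: "nat \<Rightarrow> real list set" where
  "prob_vectors n = {x. length x = n \<and> (\<forall>i<n. 0 \<le> x ! i) \<and> sum_list x = 1}"

definition qpe_vec :: "nat \<Rightarrow> real list \<Rightarrow> real list \<Rightarrow> bool" where
  "qpe_vec n x y \<longleftrightarrow> x \<in> prob_vectors n \<and> y \<in> prob_vectors n \<and>
     (\<forall>i<n. y ! i / Max (set y) \<le> x ! i / Max (set x))"

end

theory Submission
  imports Defs
begin

text \<open>Write \<open>\<rho>' = \<rho> / \<rho>\<^sup>+\<close>. Then \<open>0 \<le> \<rho>' \<le> I\<close>, some unit vector is fixed by \<open>\<rho>'\<close>, and these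
  properties characterize \<open>\<rho>'\<close> among the multiples of \<open>\<rho>\<close>; the order is \<open>\<sigma>' \<le> \<rho>'\<close>. If \<open>\<sigma>'\<close> fixes \<open>v\<close>
  and \<open>\<sigma>' \<le> \<rho>' \<le> I\<close>, then \<open>\<rho>'\<close> fixes \<open>v\<close> too, so comparable states share a top eigenvector; this
  gives maximality of pure states and all convexity statements. The kernel, tensor and eigenvalue
  statements are monotonicity of quadratic forms combined with the spectral theorem.\<close>

subsection \<open>Adjoints and the real inner product\<close>

text \<open>The obstacle behind the convexity claims is that the top eigenvalue is convex but not
  affine, so dividing by it does not commute with mixing. It is affine on a segment whose ends share
  a top eigenvector. Any two elements of a downset do, by way of the state that bounds them. Two
  elements of an upset need not: for \<open>\<rho>\<close> = diag(2,2,1)/5 the states diag(2,0,1)/3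
  and diag(0,2,1)/3 both lie above \<open>\<rho>\<close>, while their midpoint is completely mixed
  and does not. Hence an upset is only a union of convex pieces, namely segments that start at
  \<open>\<rho>\<close>. Inequalities turn into equations through one principle: if a positive
  semidefinite form vanishes at a vector, the matrix kills that vector. Closedness and isometries
  are handled through the operator norm, which agrees with the top eigenvalue on positive
  semidefinite matrices and is continuous on all matrices.\<close>

lemma map_matrix_nth [simp]: "map_matrix f A $ i $ j = f (A $ i $ j)"
  by (simp add: map_matrix_def)

lemma dagger_nth [simp]: "dagger A $ i $ j = cnj (A $ j $ i)"
  by (simp add: dagger_def transpose_def)

lemma dagger_dagger [simp]: "dagger (dagger A) = A"
  by (simp add: vec_eq_iff)

lemma dagger_mult: "dagger (A ** B) = dagger B ** dagger A"
  by (simp add: vec_eq_iff matrix_matrix_mult_def mult.commute)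

lemma dagger_diff: "dagger (A - B) = dagger A - dagger B"
  and dagger_add: "dagger (A + B) = dagger A + dagger B"
  and dagger_scaleR: "dagger (c *\<^sub>R A) = c *\<^sub>R dagger A"
  and dagger_zero [simp]: "dagger 0 = 0"
  and dagger_one [simp]: "dagger (mat 1) = mat 1"
  by (simp_all add: vec_eq_iff mat_def)

lemma cinner_vec_dagger: "cinner_vec v (A *v w) = cinner_vec (dagger A *v v) w"
proof -
  have "cinner_vec v (A *v w) = (\<Sum>i\<in>UNIV. \<Sum>j\<in>UNIV. cnj (v $ i) * A $ i $ j * w $ j)"
    by (simp add: cinner_vec_def matrix_vector_mult_def sum_distrib_left mult.assoc)
  also have "\<dots> = (\<Sum>j\<in>UNIV. \<Sum>i\<in>UNIV. cnj (v $ i) * A $ i $ j * w $ j)"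
    by (rule sum.swap)
  also have "\<dots> = cinner_vec (dagger A *v v) w"
    by (simp add: cinner_vec_def matrix_vector_mult_def sum_distrib_right sum_distrib_left mult_ac)
  finally show ?thesis .
qed

lemma Re_cinner_vec: "Re (cinner_vec v w) = v \<bullet> w"
  by (simp add: cinner_vec_def inner_vec_def inner_complex_def)

lemma inner_dagger: "v \<bullet> (A *v w) = (dagger A *v v) \<bullet> w"
  for v :: "complex^'n"
  using cinner_vec_dagger[of v A w] by (simp flip: Re_cinner_vec)

lemma cinner_vec_self: "cinner_vec v v = of_real (v \<bullet> v)"
  by (simp add: cinner_vec_def inner_vec_def complex_norm_square [symmetric] power2_norm_eq_inner mult.commute)

lemma cinner_vec_cnj: "cnj (cinner_vec v w) = cinner_vec w v"
  by (simp add: cinner_vec_def mult.commute)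

lemma cinner_vec_diff_right: "cinner_vec v (w - u) = cinner_vec v w - cinner_vec v u"
  and cinner_vec_add_right: "cinner_vec v (w + u) = cinner_vec v w + cinner_vec v u"
  and cinner_vec_scaleR_right: "cinner_vec v (c *\<^sub>R w) = of_real c * cinner_vec v w"
  and cinner_vec_smult_right: "cinner_vec v (z *s w) = z * cinner_vec v w"
  and cinner_vec_scaleR_left: "cinner_vec (c *\<^sub>R v) w = of_real c * cinner_vec v w"
  and cinner_vec_smult_left: "cinner_vec (z *s v) w = cnj z * cinner_vec v w"
  and cinner_vec_diff_left: "cinner_vec (v - u) w = cinner_vec v w - cinner_vec u w"
  by (simp_all add: cinner_vec_def algebra_simps sum.distrib sum_subtractf sum_distrib_left
        scaleR_conv_of_real[where 'a=complex])

text \<open>Reduces complex orthogonality to \<open>v\<close> to real orthogonality to the two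
  vectors \<open>v\<close> and \<open>\<i> *s v\<close>.\<close>

lemma cinner_vec_eq_inner: "cinner_vec v w = Complex (v \<bullet> w) ((\<i> *s v) \<bullet> w)"
proof -
  have "Im (cinner_vec v w) = Re (cinner_vec (\<i> *s v) w)"
    by (simp add: cinner_vec_smult_left)
  then show ?thesis
    by (simp add: complex_eq_iff Re_cinner_vec)
qed

lemma of_real_smult: "of_real r *s v = r *\<^sub>R (v :: complex^'n)"
  by (simp add: vec_eq_iff scaleR_conv_of_real[where 'a=complex])

lemma scaleR_matrix_vector: "(c *\<^sub>R A) *v v = c *\<^sub>R (A *v v)"
  and matrix_vector_scaleR: "A *v (c *\<^sub>R v) = c *\<^sub>R (A *v v)" for A :: "complex^'n^'m"
  by (simp_all add: vec_eq_iff matrix_vector_mult_def scaleR_sum_right)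

lemma matrix_scaleR_left: "(c *\<^sub>R A) ** B = c *\<^sub>R (A ** B)"
  and matrix_scaleR_right: "A ** (c *\<^sub>R B) = c *\<^sub>R (A ** B)" for A :: "complex^'n^'m"
  by (simp_all add: vec_eq_iff matrix_matrix_mult_def scaleR_sum_right)

lemma matrix_diff_ldistrib: "A ** (B - C) = A ** B - A ** C" for A :: "'a::ring_1^'n^'m"
  by (simp add: vec_eq_iff matrix_matrix_mult_def right_diff_distrib sum_subtractf)

lemma matrix_diff_rdistrib: "(A - B) ** C = A ** C - B ** C" for A :: "'a::ring_1^'n^'m"
  by (simp add: vec_eq_iff matrix_matrix_mult_def left_diff_distrib sum_subtractf)

lemma trace_scaleR: "trace (c *\<^sub>R A) = c *\<^sub>R trace A" for A :: "complex^'n^'n"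
  by (simp add: trace_def scaleR_sum_right)

lemma matrix_vector_smult: "A *v (z *s v) = z *s (A *v v)" for A :: "complex^'n^'m"
  by (simp add: vec_eq_iff matrix_vector_mult_def sum_distrib_left mult_ac)

subsection \<open>The spectral theorem\<close>

text \<open>A real dimension count: \<open>S\<close> together with \<open>\<i>\<close> times
  \<open>S\<close> spans a real subspace of dimension at most twice the size of \<open>S\<close>,
  below the real dimension \<open>2 * CARD('n)\<close> of the space.\<close>

lemma finite_orthogonal_nonzero:
  fixes S :: "(complex^'n) set"
  assumes "finite S" "card S < CARD('n)"
  obtains v where "v \<noteq> 0" "\<And>s. s \<in> S \<Longrightarrow> cinner_vec s v = 0"
proof -
  let ?S = "S \<union> (\<lambda>s. \<i> *s s) ` S"
  have "dim ?S \<le> card ?S" using assms(1) by (intro dim_le_card') simp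
  also have "\<dots> \<le> card S + card ((\<lambda>s. \<i> *s s) ` S)" by (rule card_Un_le)
  also have "\<dots> \<le> card S + card S" using card_image_le[OF assms(1)] by (rule add_left_mono)
  also have "\<dots> < DIM(complex^'n)" using assms(2) by simp
  finally obtain v where v: "v \<noteq> 0" "\<And>y. y \<in> span ?S \<Longrightarrow> orthogonal v y"
    by (rule orthogonal_to_subspace_exists) blast
  have "cinner_vec s v = 0" if "s \<in> S" for s
    using v(2)[OF span_base, of s] v(2)[OF span_base, of "\<i> *s s"] that
    by (auto simp: cinner_vec_eq_inner orthogonal_def inner_commute complex_eq_iff)
  with v(1) show thesis by (rule that)
qed

text \<open>Maximise the Rayleigh quotient on the unit sphere of the orthogonal complement; the
  gradient at the maximiser lies in the complement again and must vanish there.\<close>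

lemma hermitian_eigenvector_in_complement:
  fixes A :: "complex^'n^'n" and e :: "nat \<Rightarrow> complex^'n"
  assumes herm: "dagger A = A" and k: "k < CARD('n)"
    and e: "\<And>i. i < k \<Longrightarrow> A *v e i = a i *\<^sub>R e i"
  obtains v m where "norm v = 1" "A *v v = m *\<^sub>R v" "\<And>i. i < k \<Longrightarrow> cinner_vec (e i) v = 0"
proof -
  define W where "W = {v. \<forall>i<k. cinner_vec (e i) v = 0}"
  \<comment> \<open>Moving the Hermitian \<open>A\<close> to the left argument turns
    \<open>e i\<close> into a real multiple of itself, so the complement is invariant.\<close>
  have AW: "A *v w \<in> W" if "w \<in> W" for w
    using that by (auto simp: W_def cinner_vec_dagger herm e cinner_vec_scaleR_left)
  have W_comb: "v + c *\<^sub>R w \<in> W" "c *\<^sub>R w \<in> W" if "v \<in> W" "w \<in> W" for v w c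
    using that by (auto simp: W_def cinner_vec_add_right cinner_vec_scaleR_right)
  have "W = (\<Inter>i<k. {v. cinner_vec (e i) v = 0})" by (auto simp: W_def)
  moreover have "closed {v. cinner_vec (e i) v = 0}" for i
    unfolding cinner_vec_def by (intro closed_Collect_eq continuous_intros)
  ultimately have "closed W" by auto
  then have comp: "compact (sphere 0 1 \<inter> W)" by (intro compact_Int_closed) auto
  have "card (e ` {..<k}) < CARD('n)" using card_image_le[of "{..<k}" e] k by simp
  then obtain u where "u \<noteq> 0" "\<And>s. s \<in> e ` {..<k} \<Longrightarrow> cinner_vec s u = 0"
    by (rule finite_orthogonal_nonzero[rotated]) auto
  then have u: "u \<noteq> 0" "u \<in> W" by (auto simp: W_def)
  then have "(1 / norm u) *\<^sub>R u \<in> sphere 0 1 \<inter> W"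
    using W_comb(2)[of u u] by auto
  then have ne: "sphere 0 1 \<inter> W \<noteq> {}" by blast
  have "continuous_on (sphere 0 1 \<inter> W) (\<lambda>v. v \<bullet> (A *v v))"
    unfolding matrix_vector_mult_def by (intro continuous_intros)
  from continuous_attains_sup[OF comp ne this] obtain v where
    v: "v \<in> sphere 0 1" "v \<in> W" and max: "\<And>w. w \<in> sphere 0 1 \<inter> W \<Longrightarrow> w \<bullet> (A *v w) \<le> v \<bullet> (A *v v)"
    by blast
  define m where "m = v \<bullet> (A *v v)"
  have vv: "v \<bullet> v = 1" using v(1) by (simp add: norm_eq_sqrt_inner)
  have le: "w \<bullet> (A *v w) \<le> m * (w \<bullet> w)" if "w \<in> W" for w
  proof (cases "w = 0")
    case False
    have "(1 / norm w) *\<^sub>R w \<in> sphere 0 1 \<inter> W"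
      using False W_comb(2)[OF that that] by auto
    from max[OF this] have "(1 / norm w)\<^sup>2 * (w \<bullet> (A *v w)) \<le> m"
      by (simp add: matrix_vector_scaleR m_def power2_eq_square)
    then show ?thesis using False
      by (simp add: power_divide power2_norm_eq_inner field_simps split: if_splits)
  qed auto
  define g where "g = A *v v - m *\<^sub>R v"
  have gW: "g \<in> W" using W_comb[OF AW[OF v(2)] v(2), of "-m"] by (simp add: g_def)
  define f where "f = m * (g \<bullet> g) - g \<bullet> (A *v g)"
  have f: "f \<ge> 0" using le[OF gW] by (simp add: f_def)
  \<comment> \<open>First-order condition at the maximiser: the bound \<open>le\<close> at
    \<open>v + t *\<^sub>R g\<close> is an equality for \<open>t = 0\<close>, and its linear term in
    \<open>t\<close> is \<open>2 * (g \<bullet> g)\<close>.\<close>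
  have ineq: "2 * (g \<bullet> g) * t \<le> t\<^sup>2 * f" for t
  proof -
    have s: "g \<bullet> (A *v v) = v \<bullet> (A *v g)"
      using inner_dagger[of g A v] by (simp add: herm inner_commute)
    have "g \<bullet> g = g \<bullet> (A *v v) - m * (g \<bullet> v)"
      unfolding g_def by (simp add: inner_diff_right)
    then have gg: "v \<bullet> (A *v g) = g \<bullet> g + m * (g \<bullet> v)"
      by (simp add: s)
    have "(v + t *\<^sub>R g) \<bullet> (A *v (v + t *\<^sub>R g)) \<le> m * ((v + t *\<^sub>R g) \<bullet> (v + t *\<^sub>R g))"
      by (rule le) (intro W_comb v gW)
    then show ?thesis
      by (simp add: matrix_vector_scaleR matrix_vector_right_distrib inner_add_left inner_add_right
          s gg m_def[symmetric] f_def inner_commute[of g v] vv power2_eq_square algebra_simps)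
  qed
  have "g \<bullet> g = 0"
  proof (rule ccontr)
    assume "g \<bullet> g \<noteq> 0"
    then have p: "g \<bullet> g > 0" by simp
    \<comment> \<open>Small enough that \<open>t * f \<le> g \<bullet> g\<close>; the summand 1
      keeps the denominator positive when \<open>f = 0\<close>.\<close>
    define t where "t = (g \<bullet> g) / (f + 1)"
    have "t > 0" using p f by (simp add: t_def)
    then have "2 * (g \<bullet> g) \<le> t * f"
      using ineq[of t] by (simp add: power2_eq_square)
    also have "\<dots> \<le> g \<bullet> g" using p f by (simp add: t_def field_simps)
    finally show False using p by simp
  qed
  then have "A *v v = m *\<^sub>R v" by (simp add: g_def)
  with v show thesis by (intro that[of v m]) (auto simp: W_def)
qed

text \<open>Natural-number indices let the induction append one eigenvector at a time; the strict
  bound needed for a nonzero complement is \<open>k < CARD('n)\<close> in each step.\<close>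

lemma hermitian_orthonormal_eigenvectors:
  fixes A :: "complex^'n^'n"
  assumes herm: "dagger A = A" and "k \<le> CARD('n)"
  shows "\<exists>e a. (\<forall>i<k. A *v e i = a i *\<^sub>R e i) \<and>
    (\<forall>i<k. \<forall>j<k. cinner_vec (e i) (e j) = (if i = j then 1 else 0))"
  using assms(2)
proof (induction k)
  case (Suc k)
  then obtain e a where e: "\<And>i. i < k \<Longrightarrow> A *v e i = a i *\<^sub>R e i"
    "\<And>i j. i < k \<Longrightarrow> j < k \<Longrightarrow> cinner_vec (e i) (e j) = (if i = j then 1 else 0)"
    by auto
  obtain v m where v: "norm v = 1" "A *v v = m *\<^sub>R v" "\<And>i. i < k \<Longrightarrow> cinner_vec (e i) v = 0"
    using hermitian_eigenvector_in_complement[of A k e a, OF herm _ e(1)] Suc.prems by auto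
  have vv: "cinner_vec v v = 1" using v(1) by (simp add: cinner_vec_self norm_eq_sqrt_inner)
  have v': "cinner_vec v (e i) = 0" if "i < k" for i
    using v(3)[OF that] cinner_vec_cnj[of "e i" v] by simp
  show ?case
    by (rule exI[of _ "e(k := v)"], rule exI[of _ "a(k := m)"]) (auto simp: e v vv v' less_Suc_eq)
qed auto

definition real_diag :: "('n \<Rightarrow> real) \<Rightarrow> complex^'n^'n" where
  "real_diag a = (\<chi> i j. if i = j then of_real (a i) else 0)"

lemma real_diag_mult_vec_nth [simp]: "(real_diag a *v v) $ i = a i *\<^sub>R v $ i"
  by (simp add: real_diag_def matrix_vector_mult_def if_distrib if_distribR cong: if_cong)
     (simp add: scaleR_conv_of_real)

lemma spectral_theorem:
  fixes A :: "complex^'n^'n"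
  assumes "dagger A = A"
  obtains U a where "unitary_mat U" "A = U ** real_diag a ** dagger U"
proof -
  obtain e a where e: "\<And>i. i < CARD('n) \<Longrightarrow> A *v e i = a i *\<^sub>R e i"
    "\<And>i j. i < CARD('n) \<Longrightarrow> j < CARD('n) \<Longrightarrow> cinner_vec (e i) (e j) = (if i = j then 1 else 0)"
    using hermitian_orthonormal_eigenvectors[OF assms order.refl] by blast
  \<comment> \<open>Transports the eigenvectors, numbered by naturals, to the index type of the
    matrix columns.\<close>
  obtain h where h: "bij_betw h (UNIV :: 'n set) {0..<CARD('n)}"
    using ex_bij_betw_finite_nat[of "UNIV :: 'n set"] by auto
  have hl: "h i < CARD('n)" for i using h by (auto simp: bij_betw_def)
  have hi: "h i = h j \<longleftrightarrow> i = j" for i j using h by (auto simp: bij_betw_def inj_on_def)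
  define U :: "complex^'n^'n" where "U = (\<chi> i j. e (h j) $ i)"
  have "dagger U ** U = mat 1"
    using e(2)[OF hl hl] by (simp add: vec_eq_iff matrix_matrix_mult_def U_def mat_def cinner_vec_def hi)
  then have U: "unitary_mat U"
    by (simp add: unitary_mat_def matrix_left_right_inverse)
  have "A ** U = U ** real_diag (a \<circ> h)"
  proof -
    have "(A ** U) $ i $ j = (U ** real_diag (a \<circ> h)) $ i $ j" for i j
    proof -
      have "(A ** U) $ i $ j = (A *v e (h j)) $ i"
        by (simp add: matrix_matrix_mult_def matrix_vector_mult_def U_def)
      also have "\<dots> = a (h j) *\<^sub>R e (h j) $ i" by (simp add: e(1)[OF hl])
      also have "\<dots> = (U ** real_diag (a \<circ> h)) $ i $ j"
        by (simp add: matrix_matrix_mult_def U_def real_diag_def if_distrib if_distribR cong: if_cong)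
           (simp add: scaleR_conv_of_real)
      finally show ?thesis .
    qed
    then show ?thesis by (simp add: vec_eq_iff)
  qed
  then have "A = U ** real_diag (a \<circ> h) ** dagger U"
    using U unfolding unitary_mat_def by (metis matrix_mul_assoc matrix_mul_rid)
  with U show thesis by (rule that)
qed

subsection \<open>Positive semidefinite matrices\<close>

lemma psd_iff: "psd A \<longleftrightarrow> dagger A = A \<and> (\<forall>v. 0 \<le> v \<bullet> (A *v v))"
  by (simp add: psd_def Re_cinner_vec)

lemma psd_hermitian: "psd A \<Longrightarrow> dagger A = A"
  by (simp add: psd_def)

lemma psd_quad: "psd A \<Longrightarrow> 0 \<le> v \<bullet> (A *v v)"
  by (simp add: psd_iff)

lemma psd_zero [simp]: "psd 0"
  by (simp add: psd_iff)

lemma psd_one [simp]: "psd (mat 1)"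
  by (simp add: psd_iff)

lemma psd_add: "psd A \<Longrightarrow> psd B \<Longrightarrow> psd (A + B)"
  by (simp add: psd_iff dagger_add matrix_vector_mult_add_rdistrib inner_add_right)

lemma psd_scaleR: "psd A \<Longrightarrow> 0 \<le> c \<Longrightarrow> psd (c *\<^sub>R A)"
  by (simp add: psd_iff dagger_scaleR scaleR_matrix_vector)

lemma psd_conj: "psd A \<Longrightarrow> psd (X ** A ** dagger X)"
  by (simp add: psd_iff dagger_mult matrix_mul_assoc inner_dagger[of _ X] flip: matrix_vector_mul_assoc)

lemma psd_gram: "psd (dagger X ** X)"
  using psd_conj[OF psd_one, of "dagger X"] by simp

text \<open>Fixes an eigenbasis. The coordinates of \<open>v\<close> are
  \<open>dagger U *v v\<close>; there \<open>A\<close> acts diagonally and the inner product is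
  unchanged, so claims about \<open>A\<close> become termwise claims about the real family
  \<open>a\<close>.\<close>

locale spectral_decomposition =
  fixes A U :: "complex^'n^'n" and a :: "'n \<Rightarrow> real"
  assumes unitary: "unitary_mat U" and decomp: "A = U ** real_diag a ** dagger U"
begin

lemma U_simps [simp]: "dagger U ** U = mat 1" "U ** dagger U = mat 1"
  "dagger U *v (U *v v) = v" "U *v (dagger U *v v) = v"
  using unitary by (simp_all add: unitary_mat_def matrix_vector_mul_assoc)

lemma hermitian: "dagger A = A"
proof -
  have "dagger (real_diag a) = real_diag a" by (simp add: vec_eq_iff real_diag_def)
  then show ?thesis by (simp add: decomp dagger_mult matrix_mul_assoc)
qed

lemma coords_mult: "dagger U *v (A *v v) = real_diag a *v (dagger U *v v)"
  by (simp add: decomp flip: matrix_vector_mul_assoc)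

lemma inner_coords: "(dagger U *v v) \<bullet> (dagger U *v w) = v \<bullet> w"
  using inner_dagger[of v "U" "dagger U *v w"] by simp

lemma coords_eq_iff: "v = w \<longleftrightarrow> (\<forall>i. (dagger U *v v) $ i = (dagger U *v w) $ i)"
  by (metis U_simps(4) vec_eq_iff)

lemma quadratic_form: "v \<bullet> (A *v v) = (\<Sum>i\<in>UNIV. a i * (norm ((dagger U *v v) $ i))\<^sup>2)"
proof -
  have "v \<bullet> (A *v v) = (dagger U *v v) \<bullet> (real_diag a *v (dagger U *v v))"
    by (simp add: inner_coords flip: coords_mult)
  then show ?thesis by (simp add: inner_vec_def power2_norm_eq_inner)
qed

lemma inner_self: "v \<bullet> v = (\<Sum>i\<in>UNIV. (norm ((dagger U *v v) $ i))\<^sup>2)"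
  unfolding inner_coords[symmetric, of v] by (simp add: inner_vec_def power2_norm_eq_inner)

lemma eigenvector: "A *v (U *v axis i 1) = a i *\<^sub>R (U *v axis i 1)"
  unfolding coords_eq_iff coords_mult by (simp add: matrix_vector_scaleR axis_def)

lemma norm_eigenvector: "norm (U *v axis i 1) = 1"
  by (simp add: norm_eq_sqrt_inner inner_coords[symmetric, of "U *v axis i 1"] inner_axis_axis)

lemma eigenvalue_iff: "eigenvalue A (of_real r) \<longleftrightarrow> r \<in> range a"
proof
  assume "eigenvalue A (of_real r)"
  then obtain v where v: "v \<noteq> 0" "A *v v = r *\<^sub>R v" by (auto simp: eigenvalue_def of_real_smult)
  then obtain i where i: "(dagger U *v v) $ i \<noteq> 0"
    using coords_eq_iff[of v 0] by auto
  have "a i *\<^sub>R (dagger U *v v) $ i = r *\<^sub>R (dagger U *v v) $ i"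
    using arg_cong[OF v(2), of "\<lambda>x. (dagger U *v x) $ i"] by (simp add: coords_mult matrix_vector_scaleR)
  with i show "r \<in> range a" by auto
next
  assume "r \<in> range a"
  then obtain i where "r = a i" by auto
  then show "eigenvalue A (of_real r)"
    unfolding eigenvalue_def of_real_smult
    using eigenvector[of i] norm_eigenvector[of i] by (intro exI[of _ "U *v axis i 1"]) auto
qed

text \<open>Gives the \<open>Max\<close> in the definition its meaning: the real eigenvalues form a
  finite nonempty set.\<close>

lemma top_eigenvalue_eq: "top_eigenvalue A = Max (range a)"
  unfolding top_eigenvalue_def eigenvalue_iff by simp

lemma le_top: "a i \<le> top_eigenvalue A"
  by (simp add: top_eigenvalue_eq)

lemma trace_eq: "trace A = of_real (\<Sum>i\<in>UNIV. a i)"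
proof -
  have "trace A = trace (dagger U ** (U ** real_diag a))"
    unfolding decomp by (rule trace_mul_sym)
  also have "\<dots> = trace (real_diag a)" by (simp add: matrix_mul_assoc)
  finally show ?thesis by (simp add: trace_def real_diag_def)
qed

lemma psd_iff_eigenvalues: "psd A \<longleftrightarrow> (\<forall>i. 0 \<le> a i)"
proof
  assume "psd A"
  show "\<forall>i. 0 \<le> a i"
  proof
    fix i
    have "0 \<le> (U *v axis i 1) \<bullet> (A *v (U *v axis i 1))" using \<open>psd A\<close> by (rule psd_quad)
    then show "0 \<le> a i" using norm_eigenvector[of i]
      by (simp add: eigenvector norm_eq_sqrt_inner)
  qed
qed (auto simp: psd_iff hermitian quadratic_form intro!: sum_nonneg)

end

lemma hermitian_spectral:
  assumes "dagger A = A"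
  obtains U a where "spectral_decomposition A U a"
  using spectral_theorem[OF assms] unfolding spectral_decomposition_def by metis

subsection \<open>The top eigenvalue\<close>

lemma top_eigenvalue_bound:
  assumes "dagger A = A"
  shows "v \<bullet> (A *v v) \<le> top_eigenvalue A * (v \<bullet> v)"
proof -
  obtain U a where "spectral_decomposition A U a" using hermitian_spectral[OF assms] .
  then interpret spectral_decomposition A U a .
  show ?thesis unfolding quadratic_form inner_self sum_distrib_left
    by (intro sum_mono mult_right_mono le_top) auto
qed

lemma top_eigenvalue_attained:
  assumes "dagger A = A"
  obtains v where "norm v = 1" "A *v v = top_eigenvalue A *\<^sub>R v"
proof -
  obtain U a where "spectral_decomposition A U a" using hermitian_spectral[OF assms] .
  then interpret spectral_decomposition A U a .
  have "Max (range a) \<in> range a" by (rule Max_in) auto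
  then obtain i where "top_eigenvalue A = a i" unfolding top_eigenvalue_eq by (metis imageE)
  then show thesis using eigenvector[of i] norm_eigenvector[of i] that[of "U *v axis i 1"] by simp
qed

lemma top_eigenvalue_le:
  assumes "dagger A = A" "\<And>v. norm v = 1 \<Longrightarrow> v \<bullet> (A *v v) \<le> t"
  shows "top_eigenvalue A \<le> t"
proof -
  obtain v where v: "norm v = 1" "A *v v = top_eigenvalue A *\<^sub>R v"
    using top_eigenvalue_attained[OF assms(1)] .
  show ?thesis using assms(2)[OF v(1)] v by (simp add: norm_eq_sqrt_inner)
qed

text \<open>A certificate that avoids diagonalising: the matrix inequality bounds the top eigenvalue
  from above, the eigenvector from below.\<close>

lemma top_eigenvalue_eqI:
  assumes "dagger A = A" "psd (t *\<^sub>R mat 1 - A)" "A *v v = t *\<^sub>R v" "v \<noteq> 0"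
  shows "top_eigenvalue A = t"
proof (rule antisym)
  have "w \<bullet> (A *v w) \<le> t * (w \<bullet> w)" for w
    using psd_quad[OF assms(2), of w]
    by (simp add: matrix_vector_mult_diff_rdistrib scaleR_matrix_vector inner_diff_right)
  then show "top_eigenvalue A \<le> t"
    by (intro top_eigenvalue_le[OF assms(1)]) (metis mult.right_neutral norm_eq_1)
  show "t \<le> top_eigenvalue A"
    using top_eigenvalue_bound[OF assms(1), of v] assms(3,4) by simp
qed

lemma top_eigenvalue_psd_diff:
  assumes "dagger A = A" "top_eigenvalue A \<le> t"
  shows "psd (t *\<^sub>R mat 1 - A)"
proof -
  have "v \<bullet> (A *v v) \<le> t * (v \<bullet> v)" for v
    using top_eigenvalue_bound[OF assms(1), of v] mult_right_mono[OF assms(2), of "v \<bullet> v"] by simp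
  then show ?thesis
    by (simp add: psd_iff assms dagger_diff dagger_scaleR matrix_vector_mult_diff_rdistrib
         scaleR_matrix_vector inner_diff_right)
qed

lemma top_eigenvalue_nonneg:
  assumes "psd A"
  shows "0 \<le> top_eigenvalue A"
proof -
  obtain v where "norm v = 1" "A *v v = top_eigenvalue A *\<^sub>R v"
    using top_eigenvalue_attained[OF psd_hermitian[OF assms]] .
  then show ?thesis using psd_quad[OF assms, of v] by (simp add: norm_eq_1)
qed

lemma psd_eq_zeroI:
  assumes "psd A" "top_eigenvalue A \<le> 0"
  shows "A = 0"
proof -
  obtain U a where "spectral_decomposition A U a" using hermitian_spectral[OF psd_hermitian[OF assms(1)]] .
  then interpret spectral_decomposition A U a .
  have "a i = 0" for i
    using le_top[of i] assms psd_iff_eigenvalues by (simp add: order_antisym)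
  then have "real_diag a = 0" by (simp add: vec_eq_iff real_diag_def)
  then show ?thesis by (simp add: decomp matrix_matrix_mult_def vec_eq_iff)
qed

lemma psd_trace:
  assumes "psd A"
  shows "trace A = of_real (Re (trace A))" "0 \<le> Re (trace A)" "top_eigenvalue A \<le> Re (trace A)"
proof -
  obtain U a where "spectral_decomposition A U a" using hermitian_spectral[OF psd_hermitian[OF assms(1)]] .
  then interpret spectral_decomposition A U a .
  have nn: "0 \<le> a i" for i using assms psd_iff_eigenvalues by blast
  show "trace A = of_real (Re (trace A))" "0 \<le> Re (trace A)" by (auto simp: trace_eq nn sum_nonneg)
  have "a i \<le> (\<Sum>i\<in>UNIV. a i)" for i by (rule member_le_sum) (auto simp: nn)
  then show "top_eigenvalue A \<le> Re (trace A)" by (simp add: trace_eq top_eigenvalue_eq)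
qed

text \<open>In eigencoordinates the form is a sum of nonnegative terms \<open>a i\<close> times a
  squared modulus; if the sum vanishes, every coordinate of \<open>A *v v\<close> does.\<close>

lemma psd_kernel:
  assumes "psd A" "v \<bullet> (A *v v) \<le> 0"
  shows "A *v v = 0"
proof -
  obtain U a where "spectral_decomposition A U a" using hermitian_spectral[OF psd_hermitian[OF assms(1)]] .
  then interpret spectral_decomposition A U a .
  have nn: "0 \<le> a i" for i using assms psd_iff_eigenvalues by blast
  have "(\<Sum>i\<in>UNIV. a i * (norm ((dagger U *v v) $ i))\<^sup>2) = 0"
    using assms(2) psd_quad[OF assms(1), of v] by (simp add: quadratic_form)
  then have "a i *\<^sub>R (dagger U *v v) $ i = 0" for i
    using nn by (subst (asm) sum_nonneg_eq_0_iff) auto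
  then show ?thesis unfolding coords_eq_iff coords_mult by simp
qed

lemma real_diag_mult: "real_diag a ** real_diag b = real_diag (\<lambda>i. a i * b i)"
  by (simp add: matrix_eq vec_eq_iff flip: matrix_vector_mul_assoc)

text \<open>The factor is the square root of the diagonal part times \<open>dagger U\<close>. It
  serves the tensor product, which respects Gram factorizations.\<close>

lemma psd_factor:
  fixes A :: "complex^'n^'n"
  assumes "psd A"
  obtains X :: "complex^'n^'n" where "A = dagger X ** X"
proof -
  obtain U a where "spectral_decomposition A U a" using hermitian_spectral[OF psd_hermitian[OF assms(1)]] .
  then interpret spectral_decomposition A U a .
  have nn: "0 \<le> a i" for i using assms psd_iff_eigenvalues by blast
  let ?D = "real_diag (\<lambda>i. sqrt (a i)) :: complex^'n^'n"
  have D: "dagger ?D = ?D" by (simp add: vec_eq_iff real_diag_def)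
  have DD: "?D ** ?D = real_diag a" by (simp add: real_diag_mult nn)
  have "dagger (?D ** dagger U) ** (?D ** dagger U) = U ** ?D ** (?D ** dagger U)"
    by (simp only: dagger_mult dagger_dagger D)
  also have "\<dots> = U ** (?D ** ?D) ** dagger U" by (simp only: matrix_mul_assoc)
  finally have "A = dagger (?D ** dagger U) ** (?D ** dagger U)" by (simp only: DD decomp)
  then show thesis by (rule that)
qed

text \<open>Links the order, defined by top eigenvalues, to the norm that isometries preserve and
  whose continuity is easy to prove.\<close>

lemma psd_op_norm:
  assumes "psd A"
  shows "op_norm A = top_eigenvalue A"
proof (rule antisym)
  obtain U a where "spectral_decomposition A U a" using hermitian_spectral[OF psd_hermitian[OF assms(1)]] .
  then interpret spectral_decomposition A U a .
  have nn: "0 \<le> a i" for i using assms psd_iff_eigenvalues by blast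
  have "norm (A *v v) \<le> top_eigenvalue A * norm v" for v
  proof (rule power2_le_imp_le)
    have "(norm (A *v v))\<^sup>2 = (\<Sum>i\<in>UNIV. (a i)\<^sup>2 * (norm ((dagger U *v v) $ i))\<^sup>2)"
      unfolding power2_norm_eq_inner inner_self[of "A *v v"]
      by (simp add: coords_mult power_mult_distrib flip: power2_norm_eq_inner)
    also have "\<dots> \<le> (\<Sum>i\<in>UNIV. (top_eigenvalue A)\<^sup>2 * (norm ((dagger U *v v) $ i))\<^sup>2)"
      by (intro sum_mono mult_right_mono power_mono le_top nn) auto
    also have "\<dots> = (top_eigenvalue A * norm v)\<^sup>2"
      unfolding power_mult_distrib power2_norm_eq_inner[of v] inner_self[of v] sum_distrib_left ..
    finally show "(norm (A *v v))\<^sup>2 \<le> (top_eigenvalue A * norm v)\<^sup>2" .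
  qed (simp add: top_eigenvalue_nonneg[OF assms])
  then show "op_norm A \<le> top_eigenvalue A"
    unfolding op_norm_def by (intro onorm_bound top_eigenvalue_nonneg[OF assms])
  obtain v where v: "norm v = 1" "A *v v = top_eigenvalue A *\<^sub>R v"
    using top_eigenvalue_attained[OF hermitian] .
  have "bounded_linear ((*v) A)" by (simp flip: linear_conv_bounded_linear)
  from onorm[OF this, of v] show "top_eigenvalue A \<le> op_norm A"
    unfolding op_norm_def using v by simp
qed

lemma psd_diff_iff:
  assumes "dagger A = A" "dagger B = B"
  shows "psd (B - A) \<longleftrightarrow> (\<forall>v. v \<bullet> (A *v v) \<le> v \<bullet> (B *v v))"
  by (simp add: psd_iff dagger_diff assms matrix_vector_mult_diff_rdistrib inner_diff_right)

lemma psd_diff_trans: "psd (A - B) \<Longrightarrow> psd (B - C) \<Longrightarrow> psd (A - C)"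
  using psd_add[of "A - B" "B - C"] by simp

text \<open>The form of \<open>A - B\<close> is both nonnegative and nonpositive, so every vector
  lies in the kernel of the difference.\<close>

lemma psd_diff_antisym:
  assumes "psd (A - B)" "psd (B - A)"
  shows "A = B"
proof -
  have "(A - B) *v v = 0 *v v" for v
    using psd_quad[OF assms(2), of v]
    by (subst psd_kernel[OF assms(1)]) (simp_all add: matrix_vector_mult_diff_rdistrib inner_diff_right)
  then have "A - B = 0" unfolding matrix_eq by blast
  then show ?thesis by simp
qed

lemma psd_unitary_conj_iff:
  assumes "unitary_mat U"
  shows "psd (U ** A ** dagger U) \<longleftrightarrow> psd A"
proof
  assume "psd (U ** A ** dagger U)"
  from psd_conj[OF this, of "dagger U"]
  have "psd ((dagger U ** U) ** A ** (dagger U ** U))" by (simp add: matrix_mul_assoc)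
  then show "psd A" using assms by (simp add: unitary_mat_def)
qed (rule psd_conj)

subsection \<open>Normalized states\<close>

definition normalized :: "complex^'n^'n \<Rightarrow> complex^'n^'n" where
  "normalized \<rho> = (1 / top_eigenvalue \<rho>) *\<^sub>R \<rho>"

lemma state_psd: "\<rho> \<in> states \<Longrightarrow> psd \<rho>"
  and state_hermitian: "\<rho> \<in> states \<Longrightarrow> dagger \<rho> = \<rho>"
  and state_trace: "\<rho> \<in> states \<Longrightarrow> trace \<rho> = 1"
  by (simp_all add: states_def psd_hermitian)

lemma state_top_pos:
  assumes "\<rho> \<in> states"
  shows "0 < top_eigenvalue \<rho>"
proof (rule ccontr)
  assume "\<not> ?thesis"
  then have "\<rho> = 0" using psd_eq_zeroI[OF state_psd[OF assms]] by simp
  then show False using state_trace[OF assms] by (simp add: trace_def)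
qed

lemma qpe_iff: "\<rho> \<sqsubseteq>\<^sub>Q \<sigma> \<longleftrightarrow> \<rho> \<in> states \<and> \<sigma> \<in> states \<and> psd (normalized \<rho> - normalized \<sigma>)"
  by (simp add: qpe_def loewner_le_def normalized_def)

lemma normalized_state:
  assumes "\<rho> \<in> states"
  shows "psd (normalized \<rho>)" "psd (mat 1 - normalized \<rho>)" "top_eigenvalue \<rho> *\<^sub>R normalized \<rho> = \<rho>"
    "dagger (normalized \<rho>) = normalized \<rho>"
proof -
  note pos = state_top_pos[OF assms]
  show 1: "psd (normalized \<rho>)"
    unfolding normalized_def using pos by (intro psd_scaleR state_psd assms) simp
  then show "dagger (normalized \<rho>) = normalized \<rho>" by (rule psd_hermitian)
  have "psd ((1 / top_eigenvalue \<rho>) *\<^sub>R (top_eigenvalue \<rho> *\<^sub>R mat 1 - \<rho>))"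
    using pos by (intro psd_scaleR top_eigenvalue_psd_diff state_hermitian assms) auto
  then show "psd (mat 1 - normalized \<rho>)" using pos by (simp add: normalized_def scaleR_diff_right)
  show "top_eigenvalue \<rho> *\<^sub>R normalized \<rho> = \<rho>" using pos by (simp add: normalized_def)
qed

lemma normalized_fixed_iff:
  assumes "\<rho> \<in> states"
  shows "normalized \<rho> *v v = v \<longleftrightarrow> v \<in> top_eigenspace \<rho>"
proof -
  have "\<rho> *v v = top_eigenvalue \<rho> *\<^sub>R (normalized \<rho> *v v)"
    by (simp add: normalized_state(3)[OF assms] flip: scaleR_matrix_vector)
  then show ?thesis using state_top_pos[OF assms] by (simp add: top_eigenspace_def of_real_smult)
qed

lemma normalized_fixed:
  assumes "\<rho> \<in> states"
  obtains v where "norm v = 1" "normalized \<rho> *v v = v"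
  using top_eigenvalue_attained[OF state_hermitian[OF assms]] normalized_fixed_iff[OF assms]
  unfolding top_eigenspace_def of_real_smult by blast

text \<open>The normalizations of the completely mixed state, pure states, mixtures and tensor
  products are all computed by exhibiting such an \<open>M\<close> and \<open>v\<close>.\<close>

lemma normalized_eqI:
  assumes "\<rho> \<in> states" "\<rho> = t *\<^sub>R M" "0 < t" "psd (mat 1 - M)" "M *v v = v" "v \<noteq> 0"
  shows "top_eigenvalue \<rho> = t" "normalized \<rho> = M"
proof -
  have "psd (t *\<^sub>R (mat 1 - M))" using assms by (intro psd_scaleR) auto
  then show t: "top_eigenvalue \<rho> = t"
    using assms by (intro top_eigenvalue_eqI[OF state_hermitian[OF assms(1)]])
      (auto simp: scaleR_diff_right scaleR_matrix_vector)
  show "normalized \<rho> = M" unfolding normalized_def t using assms by simp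
qed

text \<open>Since states have trace 1, the trace of the normalized matrix is the reciprocal of the
  top eigenvalue, which recovers the lost scale.\<close>

lemma normalized_inj:
  assumes "\<rho> \<in> states" "\<sigma> \<in> states" "normalized \<rho> = normalized \<sigma>"
  shows "\<rho> = \<sigma>"
proof -
  have tr: "trace (normalized \<tau>) = of_real (1 / top_eigenvalue \<tau>)" if "\<tau> \<in> states" for \<tau> :: "complex^'a^'a"
    by (simp add: normalized_def trace_scaleR state_trace[OF that] scaleR_conv_of_real[where 'a=complex])
  have "1 / top_eigenvalue \<rho> = 1 / top_eigenvalue \<sigma>"
    using tr[OF assms(1)] tr[OF assms(2)] assms(3) by (metis of_real_eq_iff)
  then show ?thesis
    using assms(3) normalized_state(3)[OF assms(1)] normalized_state(3)[OF assms(2)]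
    by (metis div_by_1 divide_divide_eq_right mult_1)
qed

lemma qpe_refl: "\<rho> \<in> states \<Longrightarrow> \<rho> \<sqsubseteq>\<^sub>Q \<rho>"
  by (simp add: qpe_iff)

lemma qpe_trans: "\<rho> \<sqsubseteq>\<^sub>Q \<sigma> \<Longrightarrow> \<sigma> \<sqsubseteq>\<^sub>Q \<tau> \<Longrightarrow> \<rho> \<sqsubseteq>\<^sub>Q \<tau>"
  by (auto simp: qpe_iff intro: psd_diff_trans)

lemma qpe_antisym: "\<rho> \<sqsubseteq>\<^sub>Q \<sigma> \<Longrightarrow> \<sigma> \<sqsubseteq>\<^sub>Q \<rho> \<Longrightarrow> \<rho> = \<sigma>"
  by (auto simp: qpe_iff intro: normalized_inj psd_diff_antisym)

text \<open>The form of \<open>normalized \<rho>\<close> at \<open>v\<close> is squeezed between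
  \<open>v \<bullet> v\<close> from below, by comparison with \<open>\<sigma>\<close>, and from
  above, by the identity; so \<open>mat 1 - normalized \<rho>\<close> kills
  \<open>v\<close>.\<close>

lemma normalized_fixed_mono:
  assumes "\<rho> \<sqsubseteq>\<^sub>Q \<sigma>" "normalized \<sigma> *v v = v"
  shows "normalized \<rho> *v v = v"
proof -
  from assms(1) have st: "\<rho> \<in> states" "\<sigma> \<in> states" and d: "psd (normalized \<rho> - normalized \<sigma>)"
    by (auto simp: qpe_iff)
  have "v \<bullet> v \<le> v \<bullet> (normalized \<rho> *v v)"
    using psd_quad[OF d, of v] by (simp add: matrix_vector_mult_diff_rdistrib assms(2) inner_diff_right)
  then have "(mat 1 - normalized \<rho>) *v v = 0"
    by (intro psd_kernel normalized_state st) (simp add: matrix_vector_mult_diff_rdistrib inner_diff_right)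
  then show ?thesis by (simp add: matrix_vector_mult_diff_rdistrib)
qed

subsection \<open>Bottom and maximal elements\<close>

lemma completely_mixed_state: "completely_mixed \<in> states"
  by (simp add: states_def completely_mixed_def psd_scaleR trace_scaleR trace_I scaleR_conv_of_real[where 'a=complex])

text \<open>Its normalization is the identity, the upper bound of all normalized states. The axis
  vector, at an arbitrary index, only provides some nonzero fixed vector.\<close>

lemma completely_mixed_bottom:
  assumes "\<rho> \<in> states"
  shows "completely_mixed \<sqsubseteq>\<^sub>Q \<rho>"
proof -
  have "normalized completely_mixed = (mat 1 :: complex^'a^'a)"
    by (rule normalized_eqI(2)[OF completely_mixed_state, where t = "1 / CARD('a)" and v = "axis undefined 1"])
       (auto simp: completely_mixed_def)
  with normalized_state(2)[OF assms] show ?thesis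
    by (simp add: qpe_iff assms completely_mixed_state)
qed

lemma ketbra_mult: "ketbra v *v w = cinner_vec v w *s v"
  by (simp add: vec_eq_iff ketbra_def matrix_vector_mult_def cinner_vec_def sum_distrib_left mult_ac)

lemma ketbra_quad: "w \<bullet> (ketbra v *v w) = (norm (cinner_vec v w))\<^sup>2"
proof -
  have "w \<bullet> (ketbra v *v w) = Re (cinner_vec v w * cnj (cinner_vec v w))"
    by (simp add: ketbra_mult cinner_vec_smult_right cinner_vec_cnj flip: Re_cinner_vec)
  then show ?thesis by (simp only: complex_norm_square[symmetric] Re_complex_of_real)
qed

text \<open>Pythagoras for the part of \<open>w\<close> orthogonal to \<open>v\<close>.
  Nonnegativity gives the Cauchy-Schwarz bound, and vanishing gives its equality case, which
  maximality of pure states needs.\<close>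

lemma residual_inner:
  assumes "norm v = 1"
  shows "(w - cinner_vec v w *s v) \<bullet> (w - cinner_vec v w *s v) = w \<bullet> w - (norm (cinner_vec v w))\<^sup>2"
proof -
  let ?c = "cinner_vec v w"
  have "cinner_vec (w - ?c *s v) (w - ?c *s v) = cinner_vec w w - ?c * cnj ?c"
    using assms
    by (simp add: cinner_vec_diff_left cinner_vec_diff_right cinner_vec_smult_left cinner_vec_smult_right
        cinner_vec_self[of v] norm_eq_1 cinner_vec_cnj algebra_simps)
  then have "Re (cinner_vec (w - ?c *s v) (w - ?c *s v)) = Re (of_real (w \<bullet> w - (norm ?c)\<^sup>2))"
    by (simp only: complex_norm_square[symmetric] cinner_vec_self[of w] of_real_diff)
  then show ?thesis by (simp only: Re_cinner_vec Re_complex_of_real)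
qed

lemma ketbra_psd: "psd (ketbra v)"
  by (simp add: psd_iff ketbra_quad) (simp add: vec_eq_iff ketbra_def)

lemma ketbra_state:
  assumes "norm v = 1"
  shows "ketbra v \<in> states"
proof -
  have "trace (ketbra v) = cinner_vec v v"
    by (simp add: trace_def ketbra_def cinner_vec_def mult.commute)
  then show ?thesis using assms by (simp add: states_def ketbra_psd cinner_vec_self norm_eq_1)
qed

lemma normalized_ketbra:
  assumes "norm v = 1"
  shows "normalized (ketbra v) = ketbra v"
proof (rule normalized_eqI(2)[OF ketbra_state[OF assms], where t = 1 and v = v])
  have "(norm (cinner_vec v w))\<^sup>2 \<le> w \<bullet> w" for w
    using residual_inner[OF assms, of w] by (metis diff_ge_0_iff_ge inner_ge_zero)
  then show "psd (mat 1 - ketbra v)"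
    by (subst psd_diff_iff) (auto simp: psd_hermitian[OF ketbra_psd] ketbra_quad)
  show "ketbra v *v v = v" "v \<noteq> 0"
    using assms by (auto simp: ketbra_mult cinner_vec_self norm_eq_1)
qed auto

text \<open>If the Hermitian \<open>M\<close> fixes \<open>v\<close>, its form has no cross terms
  between \<open>v\<close> and the orthogonal complement, so it dominates the form of the
  projection. Conversely, domination at \<open>v\<close> itself pushes the form of \<open>M\<close>
  up to its maximum.\<close>

lemma ketbra_le_iff_fixed:
  assumes "psd M" "psd (mat 1 - M)" "norm v = 1"
  shows "psd (M - ketbra v) \<longleftrightarrow> M *v v = v"
proof
  assume "psd (M - ketbra v)"
  from psd_quad[OF this, of v] have "v \<bullet> v \<le> v \<bullet> (M *v v)"
    using assms(3) by (simp add: matrix_vector_mult_diff_rdistrib inner_diff_right ketbra_quad cinner_vec_self norm_eq_1)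
  then have "(mat 1 - M) *v v = 0"
    by (intro psd_kernel assms) (simp add: matrix_vector_mult_diff_rdistrib inner_diff_right)
  then show "M *v v = v" by (simp add: matrix_vector_mult_diff_rdistrib)
next
  assume fixed: "M *v v = v"
  have "(norm (cinner_vec v w))\<^sup>2 \<le> w \<bullet> (M *v w)" for w
  proof -
    \<comment> \<open>\<open>c *s v\<close> is the projection of \<open>w\<close> onto
      \<open>v\<close> and \<open>u\<close> the remainder; the form of \<open>M\<close> at
      \<open>w\<close> becomes \<open>(norm c)\<^sup>2 + u \<bullet> (M *v u)\<close>.\<close>
    define c u where "c = cinner_vec v w" and "u = w - c *s v"
    have w: "w = c *s v + u" by (simp add: u_def)
    have vu: "cinner_vec v u = 0"
      using assms(3) by (simp add: u_def c_def cinner_vec_diff_right cinner_vec_smult_right cinner_vec_self norm_eq_1)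
    have Mw: "M *v w = c *s v + M *v u"
      unfolding w by (simp add: matrix_vector_right_distrib matrix_vector_smult fixed)
    have "w \<bullet> (c *s v) = (norm c)\<^sup>2"
      using ketbra_quad[of w v] by (simp add: ketbra_mult c_def)
    moreover have "w \<bullet> (M *v u) = u \<bullet> (M *v u)"
    proof -
      have "w \<bullet> (M *v u) = (M *v w) \<bullet> u" by (simp add: inner_dagger psd_hermitian assms(1))
      also have "\<dots> = Re (cinner_vec (c *s v) u) + (M *v u) \<bullet> u"
        unfolding Mw by (simp add: inner_add_left Re_cinner_vec)
      also have "\<dots> = u \<bullet> (M *v u)" by (simp add: cinner_vec_smult_left vu inner_commute)
      finally show ?thesis .
    qed
    ultimately show ?thesis
      unfolding Mw inner_add_right c_def using psd_quad[OF assms(1), of u] by simp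
  qed
  then show "psd (M - ketbra v)"
    by (subst psd_diff_iff) (simp_all add: psd_hermitian assms(1) ketbra_psd ketbra_quad)
qed

lemma qpe_ketbra_iff:
  assumes "\<rho> \<in> states" "norm v = 1"
  shows "\<rho> \<sqsubseteq>\<^sub>Q ketbra v \<longleftrightarrow> v \<in> top_eigenspace \<rho>"
  using ketbra_le_iff_fixed[OF normalized_state(1,2)[OF assms(1)] assms(2)]
  by (simp add: qpe_iff assms ketbra_state normalized_ketbra normalized_fixed_iff)

text \<open>A unit vector fixed by \<open>normalized \<tau>\<close> attains equality in
  Cauchy-Schwarz with \<open>v\<close>, hence is a multiple of \<open>v\<close>. Then
  \<open>v\<close> is fixed too, which places \<open>\<tau>\<close> below the pure state, and
  antisymmetry concludes.\<close>

lemma ketbra_maximal: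
  assumes v: "norm v = 1"
  shows "qpe_maximal (ketbra v)"
  unfolding qpe_maximal_def
proof (intro conjI ballI impI ketbra_state v)
  fix \<tau> assume \<tau>: "\<tau> \<in> states" and le: "ketbra v \<sqsubseteq>\<^sub>Q \<tau>"
  obtain w where w: "norm w = 1" "normalized \<tau> *v w = w" using normalized_fixed[OF \<tau>] .
  define c where "c = cinner_vec v w"
  have "psd (ketbra v - normalized \<tau>)" using le by (simp add: qpe_iff normalized_ketbra v)
  from psd_quad[OF this, of w] have "w \<bullet> w \<le> (norm c)\<^sup>2"
    by (simp add: matrix_vector_mult_diff_rdistrib inner_diff_right ketbra_quad w c_def)
  then have "w - c *s v = 0"
    using residual_inner[OF v, of w] inner_ge_zero[of "w - c *s v"] unfolding c_def[symmetric]
    by (metis diff_le_0_iff_le inner_gt_zero_iff not_le)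
  then have wc: "w = c *s v" by simp
  then have "c \<noteq> 0" using w(1) by auto
  moreover have "c *s (normalized \<tau> *v v) = c *s v" using w(2) unfolding wc by (simp add: matrix_vector_smult)
  ultimately have "normalized \<tau> *v v = v" by (simp add: vec_eq_iff)
  then have "\<tau> \<sqsubseteq>\<^sub>Q ketbra v" using \<tau> v by (simp add: qpe_ketbra_iff normalized_fixed_iff)
  with le show "\<tau> = ketbra v" by (intro qpe_antisym)
qed

subsection \<open>Unitary conjugation and isometries\<close>

lemma unitary_dagger: "unitary_mat U \<Longrightarrow> unitary_mat (dagger U)"
  by (simp add: unitary_mat_def)

lemma unitary_conj_dagger:
  assumes "unitary_mat U"
  shows "dagger U ** (U ** A ** dagger U) ** dagger (dagger U) = A"
proof -
  have "dagger U ** (U ** A ** dagger U) ** U = (dagger U ** U) ** A ** (dagger U ** U)"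
    by (simp only: matrix_mul_assoc)
  then show ?thesis using assms by (simp add: unitary_mat_def)
qed

lemma eigenvalue_unitary_conj:
  assumes U: "unitary_mat U" and "eigenvalue A l"
  shows "eigenvalue (U ** A ** dagger U) l"
proof -
  obtain v where v: "v \<noteq> 0" "A *v v = l *s v" using assms(2) by (auto simp: eigenvalue_def)
  have inv: "dagger U *v (U *v v) = v"
    using U by (simp add: unitary_mat_def matrix_vector_mul_assoc)
  then have "U *v v \<noteq> 0" using v(1) by (metis matrix_vector_mult_0_right)
  moreover have "(U ** A ** dagger U) *v (U *v v) = l *s (U *v v)"
    by (simp only: matrix_vector_mul_assoc[symmetric] inv v(2) matrix_vector_smult)
  ultimately show ?thesis unfolding eigenvalue_def by blast
qed

lemma top_eigenvalue_unitary_conj: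
  assumes U: "unitary_mat U"
  shows "top_eigenvalue (U ** A ** dagger U) = top_eigenvalue A"
proof -
  have "eigenvalue (U ** A ** dagger U) l \<longleftrightarrow> eigenvalue A l" for l
    using eigenvalue_unitary_conj[OF U, of A l]
      eigenvalue_unitary_conj[OF unitary_dagger[OF U], of "U ** A ** dagger U" l]
    unfolding unitary_conj_dagger[OF U] by blast
  then show ?thesis by (simp add: top_eigenvalue_def)
qed

lemma state_unitary_conj:
  assumes "unitary_mat U" "\<rho> \<in> states"
  shows "U ** \<rho> ** dagger U \<in> states"
proof -
  have "trace (U ** \<rho> ** dagger U) = trace (dagger U ** (U ** \<rho>))" by (rule trace_mul_sym)
  also have "\<dots> = trace \<rho>" using assms(1) by (simp add: unitary_mat_def matrix_mul_assoc)
  finally show ?thesis using assms by (simp add: states_def psd_conj)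
qed

lemma qpe_unitary_conj_iff:
  assumes U: "unitary_mat U" and st: "\<rho> \<in> states" "\<sigma> \<in> states"
  shows "\<rho> \<sqsubseteq>\<^sub>Q \<sigma> \<longleftrightarrow> U ** \<rho> ** dagger U \<sqsubseteq>\<^sub>Q U ** \<sigma> ** dagger U"
proof -
  have "normalized (U ** \<tau> ** dagger U) = U ** normalized \<tau> ** dagger U" for \<tau>
    by (simp add: normalized_def top_eigenvalue_unitary_conj[OF U] matrix_scaleR_left matrix_scaleR_right)
  then have "normalized (U ** \<rho> ** dagger U) - normalized (U ** \<sigma> ** dagger U)
      = U ** (normalized \<rho> - normalized \<sigma>) ** dagger U"
    by (simp add: matrix_diff_ldistrib matrix_diff_rdistrib)
  then show ?thesis
    by (simp add: qpe_iff st state_unitary_conj[OF U] psd_unitary_conj_iff[OF U])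
qed

section \<open>Linear isometries that map states to states\<close>

lemma cscale_of_real: "cscale (of_real c) A = c *\<^sub>R A"
  by (simp add: cscale_def vec_eq_iff scaleR_conv_of_real[where 'a=complex])

locale state_isometry =
  fixes \<Phi> :: "complex^'n^'n \<Rightarrow> complex^'k^'k"
  assumes lin: "Vector_Spaces.linear cscale cscale \<Phi>"
    and isometric: "op_norm (\<Phi> A) = op_norm A"
    and states: "\<Phi> ` states \<subseteq> states"
begin

lemma module_hom: "module_hom cscale cscale \<Phi>"
  using lin by (simp add: linear_def Vector_Spaces.linear_def)

lemma \<Phi>_diff: "\<Phi> (A - B) = \<Phi> A - \<Phi> B"
  using module_hom by (rule module_hom.diff)

lemma \<Phi>_scaleR: "\<Phi> (c *\<^sub>R A) = c *\<^sub>R \<Phi> A"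
  using module_hom.scale[OF module_hom, of "of_real c" A] by (simp add: cscale_of_real)

text \<open>Up to a positive factor every nonzero positive semidefinite matrix is a state; trace
  zero forces the zero matrix because the trace bounds the top eigenvalue.\<close>

lemma psd_image:
  assumes "psd A"
  shows "psd (\<Phi> A)"
proof (cases "Re (trace A) = 0")
  case True
  then have "A = 0" using psd_eq_zeroI[OF assms] psd_trace(3)[OF assms] by simp
  then show ?thesis using \<Phi>_diff[of A A] by simp
next
  case False
  define r where "r = Re (trace A)"
  have r: "r > 0" using False psd_trace(2)[OF assms] by (simp add: r_def)
  have "(1 / r) *\<^sub>R A \<in> states"
    using r psd_trace(1)[OF assms] unfolding r_def[symmetric]
    by (simp add: states_def psd_scaleR assms trace_scaleR scaleR_conv_of_real[where 'a=complex])
  then have "psd (\<Phi> ((1 / r) *\<^sub>R A))" using states by (auto simp: states_def)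
  then have "psd (r *\<^sub>R \<Phi> ((1 / r) *\<^sub>R A))" using r by (intro psd_scaleR) auto
  then show ?thesis using r by (simp add: \<Phi>_scaleR)
qed

text \<open>If \<open>A\<close> had an eigenvalue \<open>-m < 0\<close>, then for \<open>c \<ge> 0\<close> bounding \<open>A\<close> the positive matrix
  \<open>c I - A\<close> would have norm at least \<open>c + m\<close>, whereas its image is at most \<open>c \<Phi>(I) \<le> c I\<close>.\<close>

lemma psd_image_iff:
  assumes herm: "dagger A = A"
  shows "psd (\<Phi> A) \<longleftrightarrow> psd A"
proof
  assume pos: "psd (\<Phi> A)"
  define c where "c = max 0 (top_eigenvalue A)"
  define B where "B = c *\<^sub>R mat 1 - A"
  have c: "0 \<le> c" "top_eigenvalue A \<le> c" by (auto simp: c_def)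
  have B: "psd B" unfolding B_def by (rule top_eigenvalue_psd_diff[OF herm c(2)])
  have "norm (axis undefined 1 :: complex^'n) = 1" by simp
  then have "(axis undefined 1 :: complex^'n) \<noteq> 0" by auto
  \<comment> \<open>The isometry carries the top eigenvalue 1 of the identity over to its image, so
    the image of the identity is at most the identity. Scaling this by \<open>c\<close> is where
    \<open>c \<ge> 0\<close> enters.\<close>
  then have "top_eigenvalue (mat 1 :: complex^'n^'n) = 1"
    by (intro top_eigenvalue_eqI[where v = "axis undefined 1"]) auto
  then have "top_eigenvalue (\<Phi> (mat 1)) = 1"
    using isometric[of "mat 1"] by (simp add: psd_op_norm psd_image)
  then have "psd (c *\<^sub>R (mat 1 - \<Phi> (mat 1)))"
    using top_eigenvalue_psd_diff[OF psd_hermitian[OF psd_image[OF psd_one]], of 1] c(1)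
    by (intro psd_scaleR) auto
  then have "psd (c *\<^sub>R (mat 1 - \<Phi> (mat 1)) + \<Phi> A)" by (rule psd_add[OF _ pos])
  then have up: "psd (c *\<^sub>R mat 1 - \<Phi> B)"
    by (simp add: B_def \<Phi>_diff \<Phi>_scaleR scaleR_diff_right diff_diff_eq2 algebra_simps)
  have "top_eigenvalue (\<Phi> B) \<le> c"
  proof (rule top_eigenvalue_le[OF psd_hermitian[OF psd_image[OF B]]])
    fix v :: "complex^'k" assume "norm v = 1"
    then show "v \<bullet> (\<Phi> B *v v) \<le> c"
      using psd_quad[OF up, of v]
      by (simp add: matrix_vector_mult_diff_rdistrib scaleR_matrix_vector inner_diff_right norm_eq_1)
  qed
  \<comment> \<open>Pulled back through the isometry, the bound says that \<open>B\<close> is at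
    most \<open>c\<close> times the identity, which is positivity of \<open>A\<close>.\<close>
  then have "top_eigenvalue B \<le> c"
    using isometric[of B] B by (simp add: psd_op_norm psd_image)
  from top_eigenvalue_psd_diff[OF psd_hermitian[OF B] this] show "psd A" by (simp add: B_def)
qed (rule psd_image)

text \<open>On states the preserved norm is the top eigenvalue, so \<open>\<Phi>\<close> commutes
  with normalization; the rest is that \<open>\<Phi>\<close> preserves and reflects positivity of
  Hermitian matrices.\<close>

lemma qpe_image_iff:
  assumes "\<rho> \<in> states" "\<sigma> \<in> states"
  shows "\<rho> \<sqsubseteq>\<^sub>Q \<sigma> \<longleftrightarrow> \<Phi> \<rho> \<sqsubseteq>\<^sub>Q \<Phi> \<sigma>"
proof -
  have "normalized (\<Phi> \<tau>) = \<Phi> (normalized \<tau>)" if "\<tau> \<in> states" for \<tau>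
    using isometric[of \<tau>] state_psd[OF that] by (simp add: normalized_def \<Phi>_scaleR psd_op_norm psd_image)
  then have "normalized (\<Phi> \<rho>) - normalized (\<Phi> \<sigma>) = \<Phi> (normalized \<rho> - normalized \<sigma>)"
    by (simp add: assms \<Phi>_diff)
  moreover have "dagger (normalized \<rho> - normalized \<sigma>) = normalized \<rho> - normalized \<sigma>"
    by (simp add: dagger_diff normalized_state assms)
  moreover have "\<Phi> \<rho> \<in> states" "\<Phi> \<sigma> \<in> states" using assms states by auto
  ultimately show ?thesis by (simp add: qpe_iff assms psd_image_iff)
qed

end

subsection \<open>Kernel and rank\<close>

text \<open>On the kernel of \<open>\<rho>\<close> the smaller form of
  \<open>normalized \<sigma>\<close> is at most zero, hence zero.\<close>

lemma qpe_ker: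
  assumes "\<rho> \<sqsubseteq>\<^sub>Q \<sigma>"
  shows "mat_ker \<rho> \<subseteq> mat_ker \<sigma>"
proof
  fix v assume "v \<in> mat_ker \<rho>"
  from assms have st: "\<rho> \<in> states" "\<sigma> \<in> states" and d: "psd (normalized \<rho> - normalized \<sigma>)"
    by (auto simp: qpe_iff)
  have "normalized \<rho> *v v = 0"
    using \<open>v \<in> mat_ker \<rho>\<close> by (simp add: mat_ker_def normalized_def scaleR_matrix_vector)
  then have "v \<bullet> (normalized \<sigma> *v v) \<le> 0"
    using psd_quad[OF d, of v] by (simp add: matrix_vector_mult_diff_rdistrib inner_diff_right)
  then have "normalized \<sigma> *v v = 0" by (intro psd_kernel normalized_state st)
  then show "v \<in> mat_ker \<sigma>"
    using state_top_pos[OF st(2)] by (simp add: mat_ker_def normalized_def scaleR_matrix_vector)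
qed

lemma rank_mult_le:
  fixes A :: "'a::field^'n^'m"
  shows "rank (X ** A) \<le> rank A"
  unfolding row_rank_def_gen
proof (rule vec.dim_mono, rule subsetI)
  fix y assume "y \<in> rows (X ** A)"
  then obtain i where y: "y = row i (X ** A)" by (auto simp: rows_def)
  have "row i (X ** A) = (\<Sum>k\<in>UNIV. X $ i $ k *s row k A)"
    by (simp add: vec_eq_iff row_def matrix_matrix_mult_def)
  also have "\<dots> \<in> vec.span (rows A)"
    by (intro vec.span_sum vec.span_scale vec.span_base) (auto simp: rows_def)
  finally show "y \<in> vec.span (rows A)" by (simp add: y)
qed

text \<open>For Hermitian \<open>A\<close> the kernel inclusion makes \<open>B\<close> factor as \<open>(B A\<^sup>+) A\<close> with \<open>A\<^sup>+\<close> the pseudoinverse.\<close>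

lemma hermitian_ker_rank:
  fixes A B :: "complex^'n^'n"
  assumes "dagger A = A" "mat_ker A \<subseteq> mat_ker B"
  shows "rank B \<le> rank A"
proof -
  obtain U a where "spectral_decomposition A U a" using hermitian_spectral[OF assms(1)] .
  then interpret spectral_decomposition A U a .
  \<comment> \<open>The pseudoinverse of \<open>A\<close>: the convention
    \<open>inverse 0 = 0\<close> treats the zero eigenvalues.\<close>
  define P where "P = U ** real_diag (\<lambda>i. inverse (a i)) ** dagger U"
  have "A *v (P *v (A *v v)) = A *v v" for v
    unfolding coords_eq_iff coords_mult P_def
    by (auto simp: coords_mult simp flip: matrix_vector_mul_assoc)
  \<comment> \<open>\<open>v - P *v (A *v v)\<close> lies in the kernel of \<open>A\<close>, hence
    in that of \<open>B\<close>.\<close>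
  then have "B *v (v - P *v (A *v v)) = 0" for v
    using subsetD[OF assms(2), of "v - P *v (A *v v)"] by (simp add: mat_ker_def matrix_vector_mult_diff_distrib)
  then have "B *v v = (B ** P ** A) *v v" for v
    by (simp add: matrix_vector_mult_diff_distrib flip: matrix_vector_mul_assoc)
  then have "B = B ** P ** A" by (simp add: matrix_eq)
  then show ?thesis using rank_mult_le[of "B ** P" A] by simp
qed

subsection \<open>Convexity\<close>

lemma state_convex:
  assumes "\<rho> \<in> states" "\<sigma> \<in> states" "0 \<le> t" "t \<le> 1"
  shows "(1 - t) *\<^sub>R \<rho> + t *\<^sub>R \<sigma> \<in> states"
proof -
  have "trace ((1 - t) *\<^sub>R \<rho> + t *\<^sub>R \<sigma>) = of_real (1 - t) + of_real t"
    by (simp only: trace_add trace_scaleR state_trace assms scaleR_conv_of_real[where 'a=complex] mult_1_right)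
  then show ?thesis
    using assms by (auto simp: states_def intro!: psd_add psd_scaleR)
qed

text \<open>States sharing a top eigenvector have additive top eigenvalue, so the normalization of
  a mixture is again a mixture of the normalizations.\<close>

lemma normalized_convex:
  assumes st: "\<rho> \<in> states" "\<sigma> \<in> states" and t: "0 \<le> t" "t \<le> 1"
    and v: "norm v = 1" "normalized \<rho> *v v = v" "normalized \<sigma> *v v = v"
  obtains s where "0 \<le> s" "s \<le> 1"
    "normalized ((1 - t) *\<^sub>R \<rho> + t *\<^sub>R \<sigma>) = (1 - s) *\<^sub>R normalized \<rho> + s *\<^sub>R normalized \<sigma>"
proof -
  let ?p = "top_eigenvalue \<rho>" and ?q = "top_eigenvalue \<sigma>"
  \<comment> \<open>\<open>T\<close> is the top eigenvalue of the mixture, attained at the shared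
    vector \<open>v\<close>. Written with normalized states, the mixture has weights
    \<open>(1 - t) * ?p\<close> and \<open>t * ?q\<close>; dividing by \<open>T\<close> makes them
    \<open>1 - s\<close> and \<open>s\<close>.\<close>
  define T where "T = (1 - t) * ?p + t * ?q"
  define s where "s = t * ?q / T"
  have pq: "?p > 0" "?q > 0" using st by (auto intro: state_top_pos)
  then have T: "T > 0" using t unfolding T_def
    by (cases "t = 0") (auto intro: add_nonneg_pos mult_nonneg_nonneg mult_pos_pos less_imp_le)
  have s0: "0 \<le> s" using t pq T by (simp add: s_def)
  have "T - t * ?q \<ge> 0" using t pq by (simp add: T_def)
  then have s1: "s \<le> 1" using T by (simp add: s_def)
  have Ts: "T * s = t * ?q" "T * (1 - s) = (1 - t) * ?p" using T by (simp_all add: s_def T_def field_simps)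
  define M where "M = (1 - s) *\<^sub>R normalized \<rho> + s *\<^sub>R normalized \<sigma>"
  have "normalized ((1 - t) *\<^sub>R \<rho> + t *\<^sub>R \<sigma>) = M"
  proof (rule normalized_eqI(2)[OF state_convex[OF st t] _ T, where v = v])
    have "(1 - t) *\<^sub>R \<rho> + t *\<^sub>R \<sigma> = ((1 - t) * ?p) *\<^sub>R normalized \<rho> + (t * ?q) *\<^sub>R normalized \<sigma>"
      by (simp add: normalized_state st flip: scaleR_scaleR)
    then show "(1 - t) *\<^sub>R \<rho> + t *\<^sub>R \<sigma> = T *\<^sub>R M"
      by (simp add: M_def scaleR_add_right Ts)
    have "mat 1 - M = (1 - s) *\<^sub>R (mat 1 - normalized \<rho>) + s *\<^sub>R (mat 1 - normalized \<sigma>)"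
      by (simp add: M_def algebra_simps)
    then show "psd (mat 1 - M)" using s0 s1 by (auto intro!: psd_add psd_scaleR normalized_state st)
    show "M *v v = v"
      by (simp add: M_def matrix_vector_mult_add_rdistrib scaleR_matrix_vector v flip: scaleR_add_left)
    show "v \<noteq> 0" using v by auto
  qed
  with s0 s1 show thesis unfolding M_def by (rule that)
qed

text \<open>Comparable states share a top eigenvector, so the normalized mixture lies on the segment
  between the normalizations; its differences to the two ends are \<open>s\<close> and
  \<open>1 - s\<close> times the same positive semidefinite matrix.\<close>

lemma qpe_convex:
  assumes le: "\<rho> \<sqsubseteq>\<^sub>Q \<sigma>" and t: "0 \<le> t" "t \<le> 1"
  shows "\<rho> \<sqsubseteq>\<^sub>Q (1 - t) *\<^sub>R \<rho> + t *\<^sub>R \<sigma>" "(1 - t) *\<^sub>R \<rho> + t *\<^sub>R \<sigma> \<sqsubseteq>\<^sub>Q \<sigma>"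
proof -
  have st: "\<rho> \<in> states" "\<sigma> \<in> states" and d: "psd (normalized \<rho> - normalized \<sigma>)"
    using le by (auto simp: qpe_iff)
  obtain v where v: "norm v = 1" "normalized \<sigma> *v v = v" using normalized_fixed[OF st(2)] .
  obtain s where s: "0 \<le> s" "s \<le> 1"
    "normalized ((1 - t) *\<^sub>R \<rho> + t *\<^sub>R \<sigma>) = (1 - s) *\<^sub>R normalized \<rho> + s *\<^sub>R normalized \<sigma>"
    using normalized_convex[OF st t v(1) normalized_fixed_mono[OF le v(2)] v(2)] .
  have "psd (s *\<^sub>R (normalized \<rho> - normalized \<sigma>))" "psd ((1 - s) *\<^sub>R (normalized \<rho> - normalized \<sigma>))"
    using s d by (auto intro: psd_scaleR)
  moreover have "s *\<^sub>R (normalized \<rho> - normalized \<sigma>) = normalized \<rho> - normalized ((1 - t) *\<^sub>R \<rho> + t *\<^sub>R \<sigma>)"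
    "(1 - s) *\<^sub>R (normalized \<rho> - normalized \<sigma>) = normalized ((1 - t) *\<^sub>R \<rho> + t *\<^sub>R \<sigma>) - normalized \<sigma>"
    unfolding s(3) by (simp_all add: algebra_simps)
  ultimately show "\<rho> \<sqsubseteq>\<^sub>Q (1 - t) *\<^sub>R \<rho> + t *\<^sub>R \<sigma>" "(1 - t) *\<^sub>R \<rho> + t *\<^sub>R \<sigma> \<sqsubseteq>\<^sub>Q \<sigma>"
    by (simp_all add: qpe_iff st state_convex[OF st t])
qed

text \<open>Supplies the closed convex pieces of an upset.\<close>

lemma segment_subset_upset:
  assumes "\<rho> \<sqsubseteq>\<^sub>Q \<sigma>"
  shows "closed_segment \<rho> \<sigma> \<subseteq> {\<sigma>' \<in> states. \<rho> \<sqsubseteq>\<^sub>Q \<sigma>'}"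
proof
  fix x assume "x \<in> closed_segment \<rho> \<sigma>"
  then obtain t where "0 \<le> t" "t \<le> 1" "x = (1 - t) *\<^sub>R \<rho> + t *\<^sub>R \<sigma>" by (auto simp: in_segment)
  then have "\<rho> \<sqsubseteq>\<^sub>Q x" using qpe_convex(1)[OF assms] by simp
  then show "x \<in> {\<sigma>' \<in> states. \<rho> \<sqsubseteq>\<^sub>Q \<sigma>'}" by (simp add: qpe_iff)
qed

text \<open>A top eigenvector of \<open>\<sigma>\<close> is one for everything below
  \<open>\<sigma>\<close>, so any two elements of the downset can be mixed after
  normalization.\<close>

lemma convex_downset: "convex {\<rho> \<in> states. \<rho> \<sqsubseteq>\<^sub>Q \<sigma>}"
  unfolding convex_alt
proof (intro ballI allI impI)
  fix \<alpha> \<beta> and t :: real assume "\<alpha> \<in> {\<rho> \<in> states. \<rho> \<sqsubseteq>\<^sub>Q \<sigma>}" "\<beta> \<in> {\<rho> \<in> states. \<rho> \<sqsubseteq>\<^sub>Q \<sigma>}" "0 \<le> t \<and> t \<le> 1"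
  then have le: "\<alpha> \<sqsubseteq>\<^sub>Q \<sigma>" "\<beta> \<sqsubseteq>\<^sub>Q \<sigma>" and t: "0 \<le> t" "t \<le> 1" by auto
  then have st: "\<alpha> \<in> states" "\<beta> \<in> states" "\<sigma> \<in> states"
    and d: "psd (normalized \<alpha> - normalized \<sigma>)" "psd (normalized \<beta> - normalized \<sigma>)"
    by (auto simp: qpe_iff)
  obtain v where v: "norm v = 1" "normalized \<sigma> *v v = v" using normalized_fixed[OF st(3)] .
  obtain s where s: "0 \<le> s" "s \<le> 1"
    "normalized ((1 - t) *\<^sub>R \<alpha> + t *\<^sub>R \<beta>) = (1 - s) *\<^sub>R normalized \<alpha> + s *\<^sub>R normalized \<beta>"
    using normalized_convex[OF st(1,2) t v(1) normalized_fixed_mono[OF le(1) v(2)] normalized_fixed_mono[OF le(2) v(2)]] .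
  have "normalized ((1 - t) *\<^sub>R \<alpha> + t *\<^sub>R \<beta>) - normalized \<sigma>
      = (1 - s) *\<^sub>R (normalized \<alpha> - normalized \<sigma>) + s *\<^sub>R (normalized \<beta> - normalized \<sigma>)"
    unfolding s(3) by (simp add: algebra_simps)
  also have "psd \<dots>" using s d by (auto intro!: psd_add psd_scaleR)
  finally show "(1 - t) *\<^sub>R \<alpha> + t *\<^sub>R \<beta> \<in> {\<rho> \<in> states. \<rho> \<sqsubseteq>\<^sub>Q \<sigma>}"
    by (simp add: qpe_iff st state_convex[OF st(1,2) t])
qed

subsection \<open>Closedness\<close>

lemma bounded_bilinear_matrix_vector: "bounded_bilinear ((*v) :: complex^'n^'m \<Rightarrow> _)"
proof -
  have "bilinear ((*v) :: complex^'n^'m \<Rightarrow> _)"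
    by (auto simp: bilinear_def linear_iff matrix_vector_right_distrib matrix_vector_mult_add_rdistrib
        matrix_vector_scaleR scaleR_matrix_vector)
  then show ?thesis by (simp add: bilinear_conv_bounded_bilinear)
qed

text \<open>The triangle inequality and a bound of the operator norm by a multiple \<open>K\<close>
  of the ambient norm make it \<open>K\<close>-Lipschitz.\<close>

lemma continuous_on_op_norm: "continuous_on S (op_norm :: complex^'n^'m \<Rightarrow> real)"
proof -
  interpret bounded_bilinear "(*v) :: complex^'n^'m \<Rightarrow> _" by (rule bounded_bilinear_matrix_vector)
  obtain K where K: "K > 0" "\<And>(A :: complex^'n^'m) v. norm (A *v v) \<le> norm A * norm v * K"
    using pos_bounded by blast
  have le: "op_norm A \<le> op_norm B + K * norm (A - B)" for A B :: "complex^'n^'m"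
  proof -
    have "onorm (\<lambda>v. B *v v + (A - B) *v v) \<le> onorm ((*v) B) + onorm ((*v) (A - B))"
      by (intro onorm_triangle bounded_linear_right)
    moreover have "onorm ((*v) (A - B)) \<le> K * norm (A - B)"
      using K by (intro onorm_bound) (auto simp: mult_ac)
    ultimately show ?thesis
      by (simp add: op_norm_def flip: matrix_vector_mult_add_rdistrib)
  qed
  have "K-lipschitz_on S (op_norm :: complex^'n^'m \<Rightarrow> real)"
  proof (rule lipschitz_onI)
    fix A B :: "complex^'n^'m"
    show "dist (op_norm A) (op_norm B) \<le> K * dist A B"
      using le[of A B] le[of B A] by (auto simp: dist_norm norm_minus_commute[of B A])
  qed (use K in auto)
  then show ?thesis by (rule lipschitz_on_continuous_on)
qed

text \<open>Clearing denominators leaves, for each \<open>v\<close>, an inequality between functions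
  continuous on all pairs of matrices, hence a closed condition.\<close>

lemma qpe_iff_quad:
  assumes "\<rho> \<in> states" "\<sigma> \<in> states"
  shows "\<rho> \<sqsubseteq>\<^sub>Q \<sigma> \<longleftrightarrow> (\<forall>v. op_norm \<rho> * (v \<bullet> (\<sigma> *v v)) \<le> op_norm \<sigma> * (v \<bullet> (\<rho> *v v)))"
proof -
  have "\<rho> \<sqsubseteq>\<^sub>Q \<sigma> \<longleftrightarrow> (\<forall>v. v \<bullet> (normalized \<sigma> *v v) \<le> v \<bullet> (normalized \<rho> *v v))"
    by (simp add: qpe_iff assms psd_diff_iff normalized_state)
  then show ?thesis
    using state_top_pos[OF assms(1)] state_top_pos[OF assms(2)]
    by (simp add: normalized_def scaleR_matrix_vector psd_op_norm state_psd assms field_simps)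
qed

lemma closed_qpe_graph:
  "closedin (top_of_set (states \<times> states)) {(\<alpha> :: complex^'n^'n, \<beta>). \<alpha> \<sqsubseteq>\<^sub>Q \<beta>}"
proof -
  let ?C = "\<Inter>v. {p :: (complex^'n^'n) \<times> (complex^'n^'n).
    op_norm (fst p) * (v \<bullet> (snd p *v v)) \<le> op_norm (snd p) * (v \<bullet> (fst p *v v))}"
  have "closed ?C"
    by (intro closed_INT ballI closed_Collect_le continuous_intros
        bounded_bilinear.continuous_on[OF bounded_bilinear_matrix_vector]
        continuous_on_compose2[OF continuous_on_op_norm[of UNIV]]) auto
  moreover have "{(\<alpha> :: complex^'n^'n, \<beta>). \<alpha> \<sqsubseteq>\<^sub>Q \<beta>} = (states \<times> states) \<inter> ?C"
  proof (rule set_eqI)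
    fix p :: "(complex^'n^'n) \<times> (complex^'n^'n)"
    obtain \<alpha> \<beta> where p: "p = (\<alpha>, \<beta>)" by (cases p)
    show "p \<in> {(\<alpha>, \<beta>). \<alpha> \<sqsubseteq>\<^sub>Q \<beta>} \<longleftrightarrow> p \<in> (states \<times> states) \<inter> ?C"
      using qpe_iff_quad[of \<alpha> \<beta>] by (auto simp: p qpe_iff)
  qed
  ultimately show ?thesis by (simp only: closedin_closed_Int)
qed

lemma pospace_qpe: "pospace_on states {(\<alpha> :: complex^'n^'n, \<beta>). \<alpha> \<sqsubseteq>\<^sub>Q \<beta>}"
  unfolding pospace_on_def partial_order_on_def preorder_on_def
proof (intro conjI closed_qpe_graph)
  show "refl_on states {(\<alpha> :: complex^'n^'n, \<beta>). \<alpha> \<sqsubseteq>\<^sub>Q \<beta>}"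
    by (auto simp: refl_on_def qpe_refl)
  show "trans {(\<alpha> :: complex^'n^'n, \<beta>). \<alpha> \<sqsubseteq>\<^sub>Q \<beta>}"
    by (auto intro!: transI intro: qpe_trans)
  show "antisym {(\<alpha> :: complex^'n^'n, \<beta>). \<alpha> \<sqsubseteq>\<^sub>Q \<beta>}"
    by (auto intro!: antisymI intro: qpe_antisym)
qed (auto simp: qpe_iff)

text \<open>Sections are preimages under continuous embeddings; downsets and upsets thus inherit
  closedness from the graph of the order.\<close>

lemma closedin_section:
  assumes "closedin (top_of_set (S \<times> T)) r"
  shows "x \<in> S \<Longrightarrow> closedin (top_of_set T) {y \<in> T. (x, y) \<in> r}"
    and "y \<in> T \<Longrightarrow> closedin (top_of_set S) {x \<in> S. (x, y) \<in> r}"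
proof -
  show "closedin (top_of_set T) {y \<in> T. (x, y) \<in> r}" if "x \<in> S"
  proof -
    have "closedin (top_of_set T) (T \<inter> (\<lambda>y. (x, y)) -` r)"
      by (rule continuous_closedin_preimage_gen[OF _ _ assms])
        (use that in \<open>auto intro!: continuous_on_Pair\<close>)
    then show ?thesis by (simp add: vimage_def Collect_conj_eq)
  qed
  show "closedin (top_of_set S) {x \<in> S. (x, y) \<in> r}" if "y \<in> T"
  proof -
    have "closedin (top_of_set S) (S \<inter> (\<lambda>x. (x, y)) -` r)"
      by (rule continuous_closedin_preimage_gen[OF _ _ assms])
        (use that in \<open>auto intro!: continuous_on_Pair\<close>)
    then show ?thesis by (simp add: vimage_def Collect_conj_eq)
  qed
qed

subsection \<open>Tensor products\<close>

lemma tensor_nth [simp]: "(A \<otimes>\<^sub>Q B) $ i $ j = A $ fst i $ fst j * B $ snd i $ snd j"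
  by (simp add: tensor_def)

lemma tensor_mult: "(A \<otimes>\<^sub>Q B) ** (C \<otimes>\<^sub>Q D) = (A ** C) \<otimes>\<^sub>Q (B ** D)"
proof -
  have "(\<Sum>k\<in>UNIV. A $ fst i $ fst k * B $ snd i $ snd k * (C $ fst k $ fst j * D $ snd k $ snd j))
     = (\<Sum>k\<in>UNIV. A $ fst i $ k * C $ k $ fst j) * (\<Sum>k\<in>UNIV. B $ snd i $ k * D $ k $ snd j)" for i j
    unfolding sum_product sum.cartesian_product UNIV_Times_UNIV
    by (intro sum.cong) (auto simp: mult_ac)
  then show ?thesis by (simp add: vec_eq_iff matrix_matrix_mult_def)
qed

lemma tensor_dagger: "dagger (A \<otimes>\<^sub>Q B) = dagger A \<otimes>\<^sub>Q dagger B"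
  by (simp add: vec_eq_iff)

lemma tensor_trace: "trace (A \<otimes>\<^sub>Q B) = trace A * trace B"
  unfolding trace_def sum_product sum.cartesian_product UNIV_Times_UNIV
  by (intro sum.cong) auto

lemma tensor_diff_left: "(A - A') \<otimes>\<^sub>Q B = A \<otimes>\<^sub>Q B - A' \<otimes>\<^sub>Q B"
  and tensor_diff_right: "A \<otimes>\<^sub>Q (B - B') = A \<otimes>\<^sub>Q B - A \<otimes>\<^sub>Q B'"
  and tensor_one: "mat 1 \<otimes>\<^sub>Q mat 1 = mat 1"
  and tensor_scaleR: "(c *\<^sub>R A) \<otimes>\<^sub>Q (d *\<^sub>R B) = (c * d) *\<^sub>R (A \<otimes>\<^sub>Q B)"
  by (auto simp: vec_eq_iff algebra_simps mat_def prod_eq_iff)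

text \<open>Gram factorizations of the two matrices tensor to a Gram factorization of the
  product.\<close>

lemma tensor_psd:
  fixes A :: "complex^'a^'a" and B :: "complex^'b^'b"
  assumes "psd A" "psd B"
  shows "psd (A \<otimes>\<^sub>Q B)"
proof -
  obtain X :: "complex^'a^'a" where "A = dagger X ** X" using psd_factor[OF assms(1)] .
  moreover obtain Y :: "complex^'b^'b" where "B = dagger Y ** Y" using psd_factor[OF assms(2)] .
  ultimately have "A \<otimes>\<^sub>Q B = dagger (X \<otimes>\<^sub>Q Y) ** (X \<otimes>\<^sub>Q Y)" by (simp add: tensor_mult tensor_dagger)
  then show ?thesis by (simp add: psd_gram)
qed

definition vec_tensor :: "complex^'a \<Rightarrow> complex^'b \<Rightarrow> complex^('a \<times> 'b)" where
  "vec_tensor v w = (\<chi> i. v $ fst i * w $ snd i)"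

lemma tensor_mult_vec: "(A \<otimes>\<^sub>Q B) *v vec_tensor v w = vec_tensor (A *v v) (B *v w)"
proof -
  have "(\<Sum>k\<in>UNIV. A $ fst i $ fst k * B $ snd i $ snd k * (v $ fst k * w $ snd k))
     = (\<Sum>k\<in>UNIV. A $ fst i $ k * v $ k) * (\<Sum>k\<in>UNIV. B $ snd i $ k * w $ k)" for i
    unfolding sum_product sum.cartesian_product UNIV_Times_UNIV
    by (intro sum.cong) (auto simp: mult_ac)
  then show ?thesis by (simp add: vec_eq_iff matrix_vector_mult_def vec_tensor_def)
qed

lemma vec_tensor_nonzero:
  assumes "v \<noteq> 0" "w \<noteq> 0"
  shows "vec_tensor v w \<noteq> 0"
proof -
  obtain i j where "v $ i \<noteq> 0" "w $ j \<noteq> 0" using assms by (auto simp: vec_eq_iff)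
  then have "vec_tensor v w $ (i, j) \<noteq> 0" by (simp add: vec_tensor_def)
  then show ?thesis by (metis zero_index)
qed

text \<open>Exchange one factor at a time. With identities as the larger matrices this also bounds a
  tensor product of normalized states by the identity.\<close>

lemma tensor_diff_psd:
  assumes "psd (A - A')" "psd (B - B')" "psd A'" "psd B"
  shows "psd (A \<otimes>\<^sub>Q B - A' \<otimes>\<^sub>Q B')"
proof -
  have "A \<otimes>\<^sub>Q B - A' \<otimes>\<^sub>Q B' = (A - A') \<otimes>\<^sub>Q B + A' \<otimes>\<^sub>Q (B - B')"
    by (simp add: tensor_diff_left tensor_diff_right)
  then show ?thesis by (simp add: psd_add tensor_psd assms)
qed

lemma tensor_state: "\<rho> \<in> states \<Longrightarrow> \<sigma> \<in> states \<Longrightarrow> \<rho> \<otimes>\<^sub>Q \<sigma> \<in> states"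
  by (simp add: states_def tensor_psd tensor_trace)

lemma normalized_tensor:
  assumes "\<rho> \<in> states" "\<sigma> \<in> states"
  shows "normalized (\<rho> \<otimes>\<^sub>Q \<sigma>) = normalized \<rho> \<otimes>\<^sub>Q normalized \<sigma>"
proof -
  obtain v where v: "norm v = 1" "normalized \<rho> *v v = v" using normalized_fixed[OF assms(1)] .
  obtain w where w: "norm w = 1" "normalized \<sigma> *v w = w" using normalized_fixed[OF assms(2)] .
  show ?thesis
  proof (rule normalized_eqI(2)[where t = "top_eigenvalue \<rho> * top_eigenvalue \<sigma>" and v = "vec_tensor v w"])
    show "\<rho> \<otimes>\<^sub>Q \<sigma> \<in> states" using assms by (rule tensor_state)
    show "\<rho> \<otimes>\<^sub>Q \<sigma> = (top_eigenvalue \<rho> * top_eigenvalue \<sigma>) *\<^sub>R (normalized \<rho> \<otimes>\<^sub>Q normalized \<sigma>)"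
      by (simp add: normalized_state assms flip: tensor_scaleR)
    show "0 < top_eigenvalue \<rho> * top_eigenvalue \<sigma>" using assms by (simp add: state_top_pos)
    show "psd (mat 1 - normalized \<rho> \<otimes>\<^sub>Q normalized \<sigma>)"
      unfolding tensor_one[symmetric] by (intro tensor_diff_psd normalized_state assms psd_one)
    show "(normalized \<rho> \<otimes>\<^sub>Q normalized \<sigma>) *v vec_tensor v w = vec_tensor v w"
      by (simp add: tensor_mult_vec v w)
    show "vec_tensor v w \<noteq> 0" using v w by (intro vec_tensor_nonzero) auto
  qed
qed

lemma qpe_tensor:
  assumes "\<rho>1 \<sqsubseteq>\<^sub>Q \<sigma>1" "\<rho>2 \<sqsubseteq>\<^sub>Q \<sigma>2"
  shows "\<rho>1 \<otimes>\<^sub>Q \<rho>2 \<sqsubseteq>\<^sub>Q \<sigma>1 \<otimes>\<^sub>Q \<sigma>2"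
  using assms by (auto simp: qpe_iff tensor_state normalized_tensor normalized_state intro!: tensor_diff_psd)

subsection \<open>Ordered eigenvalues\<close>

lemma const_poly_sum: "(\<Sum>i\<in>S. [:f i:]) = [:\<Sum>i\<in>S. f i:]"
  by (induction S rule: infinite_finite_induct) auto

lemma map_matrix_const_poly_mult:
  fixes A B :: "complex^'n^'n"
  shows "map_matrix (\<lambda>a. [:a:]) (A ** B) = map_matrix (\<lambda>a. [:a:]) A ** map_matrix (\<lambda>a. [:a:]) B"
  by (simp add: vec_eq_iff matrix_matrix_mult_def mult.commute flip: const_poly_sum)

lemma mat_commute: "mat k ** A = A ** mat k" for A :: "'a::comm_ring_1^'n^'n"
proof -
  have "(mat k ** A) $ i $ j = k * A $ i $ j" for i j
    by (simp add: mat_def matrix_matrix_mult_def if_distrib if_distribR cong: if_cong)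
  moreover have "(A ** mat k) $ i $ j = A $ i $ j * k" for i j
    by (simp add: mat_def matrix_matrix_mult_def if_distrib if_distribR cong: if_cong)
  ultimately show ?thesis by (simp add: vec_eq_iff mult.commute)
qed

context spectral_decomposition
begin

text \<open>Conjugation is carried out over the polynomial ring, with \<open>U\<close> lifted to
  constant polynomials: the scalar matrix of the variable is central, and the determinants of the
  lifted \<open>U\<close> and \<open>dagger U\<close> multiply to 1.\<close>

lemma charpoly_eq: "charpoly A = (\<Prod>i\<in>UNIV. [:- of_real (a i), 1:])"
proof -
  let ?C = "map_matrix (\<lambda>a. [:a:]) :: complex^'n^'n \<Rightarrow> complex poly^'n^'n"
  let ?X = "mat [:0, 1:] :: complex poly^'n^'n"
  have one: "?C (mat 1) = mat 1" by (simp add: vec_eq_iff mat_def one_pCons)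
  have UU: "?C U ** ?C (dagger U) = mat 1"
    by (simp add: one flip: map_matrix_const_poly_mult)
  have "?X = ?C U ** ?X ** ?C (dagger U)"
    by (simp add: mat_commute[of _ "?C U", symmetric] UU flip: matrix_mul_assoc)
  then have "?X - ?C A = ?C U ** ?X ** ?C (dagger U) - ?C U ** ?C (real_diag a) ** ?C (dagger U)"
    by (simp add: decomp map_matrix_const_poly_mult)
  also have "\<dots> = ?C U ** (?X - ?C (real_diag a)) ** ?C (dagger U)"
    by (simp only: matrix_diff_ldistrib matrix_diff_rdistrib)
  finally have "charpoly A = det (?C U) * det (?X - ?C (real_diag a)) * det (?C (dagger U))"
    by (simp add: charpoly_def det_mul)
  also have "\<dots> = det (?X - ?C (real_diag a)) * det (?C U ** ?C (dagger U))"
    by (simp add: det_mul)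
  also have "\<dots> = det (?X - ?C (real_diag a))" by (simp add: UU)
  also have "\<dots> = (\<Prod>i\<in>UNIV. [:- of_real (a i), 1:])"
    by (subst det_diagonal) (auto simp: mat_def real_diag_def)
  finally show ?thesis .
qed

text \<open>With the sorting forgotten, the algebraic multiplicities are those of the family
  \<open>a\<close>; length, range, sum and counts then follow by applying functions of
  multisets.\<close>

lemma mset_ordered_eigenvalues: "mset (ordered_eigenvalues A) = image_mset a (mset_set UNIV)"
proof -
  have sum: "(\<Sum>i\<in>S. {#f i#}) = image_mset f (mset_set S)" if "finite S" for f :: "'n \<Rightarrow> complex" and S
    using that by (induction S rule: finite_induct) auto
  have "proots (charpoly A) = (\<Sum>i\<in>UNIV. proots [:- of_real (a i), 1:])"
    unfolding charpoly_eq by (rule proots_prod) simp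
  also have "\<dots> = image_mset (\<lambda>i. of_real (a i)) (mset_set UNIV)"
    by (simp add: sum)
  finally show ?thesis by (simp add: ordered_eigenvalues_def multiset.map_comp comp_def)
qed

lemma length_ordered_eigenvalues: "length (ordered_eigenvalues A) = CARD('n)"
  using arg_cong[OF mset_ordered_eigenvalues, of size] by simp

lemma set_ordered_eigenvalues: "set (ordered_eigenvalues A) = range a"
  using arg_cong[OF mset_ordered_eigenvalues, of set_mset] by simp

lemma Max_ordered_eigenvalues: "Max (set (ordered_eigenvalues A)) = top_eigenvalue A"
  by (simp add: set_ordered_eigenvalues top_eigenvalue_eq)

lemma sum_ordered_eigenvalues: "sum_list (ordered_eigenvalues A) = (\<Sum>i\<in>UNIV. a i)"
  using arg_cong[OF mset_ordered_eigenvalues, of sum_mset] by (simp add: sum_mset_sum_list sum_unfold_sum_mset)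

text \<open>Translates counts of list positions into counts of eigenvector indices, which dimension
  arguments can use.\<close>

lemma length_filter_ordered_eigenvalues:
  "length (filter P (ordered_eigenvalues A)) = card {i. P (a i)}"
proof -
  have "length (filter P (ordered_eigenvalues A)) = size (filter_mset P (mset (ordered_eigenvalues A)))"
    by (simp flip: mset_filter)
  also have "\<dots> = card {i. P (a i)}"
    by (simp add: mset_ordered_eigenvalues filter_mset_image_mset filter_mset_mset_set)
  finally show ?thesis .
qed

lemma coords_nth: "(dagger U *v v) $ i = cinner_vec (U *v axis i 1) v"
  unfolding cinner_vec_dagger[of _ "dagger U", simplified, symmetric]
  by (simp add: cinner_vec_def axis_def if_distrib if_distribR cong: if_cong)

lemma spectral_decomposition_scaleR: "spectral_decomposition (c *\<^sub>R A) U (\<lambda>i. c * a i)"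
proof -
  have "real_diag (\<lambda>i. c * a i) = c *\<^sub>R real_diag a"
    by (simp add: vec_eq_iff real_diag_def scaleR_conv_of_real[where 'a=complex])
  then show ?thesis
    by unfold_locales (simp_all add: unitary decomp matrix_scaleR_left matrix_scaleR_right)
qed

end

section \<open>Monotonicity of sorted eigenvalues under the matrix order\<close>

lemma ordered_eigenvalues_antimono:
  "i \<le> j \<Longrightarrow> j < length (ordered_eigenvalues A) \<Longrightarrow> ordered_eigenvalues A ! j \<le> ordered_eigenvalues A ! i"
  by (rule sorted_rev_nth_mono) (simp_all add: ordered_eigenvalues_def)

text \<open>Otherwise the span of the eigenvectors of \<open>A\<close> below \<open>t\<close> would meet the span of those of \<open>B\<close>
  above \<open>t\<close> in a nonzero vector, on which the two quadratic forms contradict \<open>B \<le> A\<close>.\<close>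

lemma eigenvalue_count:
  fixes A B :: "complex^'n^'n"
  assumes A: "spectral_decomposition A U a" and B: "spectral_decomposition B V b"
    and le: "psd (A - B)"
  shows "card {i. a i < t} + card {i. t \<le> b i} \<le> CARD('n)"
proof (rule ccontr)
  interpret A: spectral_decomposition A U a by (rule A)
  interpret B: spectral_decomposition B V b by (rule B)
  assume less: "\<not> ?thesis"
  \<comment> \<open>A vector lies in both spans exactly when it is orthogonal to the remaining
    eigenvectors of \<open>A\<close> and of \<open>B\<close>. If the claimed bound fails, fewer than
    \<open>CARD('n)\<close> of these remain.\<close>
  let ?S = "(\<lambda>i. U *v axis i 1) ` {i. t \<le> a i} \<union> (\<lambda>i. V *v axis i 1) ` {i. b i < t}"
  have compl: "card {i. t \<le> f i} = CARD('n) - card {i. f i < t}" "card {i. f i < t} \<le> CARD('n)"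
    for f :: "'n \<Rightarrow> real"
  proof -
    have "{i. t \<le> f i} = - {i. f i < t}" by auto
    then show "card {i. t \<le> f i} = CARD('n) - card {i. f i < t}" by (simp add: Compl_eq_Diff_UNIV card_Diff_subset)
  qed (intro card_mono; simp)
  have "card ?S \<le> card {i. t \<le> a i} + card {i. b i < t}"
    by (rule order_trans[OF card_Un_le]) (intro add_mono card_image_le; simp)
  also have "\<dots> < CARD('n)" using less compl[of a] compl[of b] by linarith
  finally obtain v where v: "v \<noteq> 0" "\<And>s. s \<in> ?S \<Longrightarrow> cinner_vec s v = 0"
    by (rule finite_orthogonal_nonzero[rotated]) auto
  have zA: "(dagger U *v v) $ i = 0" if "t \<le> a i" for i
    using v(2) that by (auto simp: A.coords_nth)
  have zB: "(dagger V *v v) $ i = 0" if "b i < t" for i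
    using v(2) that by (auto simp: B.coords_nth)
  obtain k where k: "(dagger U *v v) $ k \<noteq> 0" using v(1) A.coords_eq_iff[of v 0] by auto
  have "t * (v \<bullet> v) \<le> v \<bullet> (B *v v)"
    unfolding B.quadratic_form B.inner_self sum_distrib_left
  proof (rule sum_mono)
    fix i show "t * (norm ((dagger V *v v) $ i))\<^sup>2 \<le> b i * (norm ((dagger V *v v) $ i))\<^sup>2"
      using zB[of i] by (cases "b i < t") (auto intro: mult_right_mono)
  qed
  also have "\<dots> \<le> v \<bullet> (A *v v)"
    using psd_quad[OF le, of v] by (simp add: matrix_vector_mult_diff_rdistrib inner_diff_right)
  also have "\<dots> < t * (v \<bullet> v)"
    unfolding A.quadratic_form A.inner_self sum_distrib_left
  proof (rule sum_strict_mono_ex1)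
    show "\<forall>i\<in>UNIV. a i * (norm ((dagger U *v v) $ i))\<^sup>2 \<le> t * (norm ((dagger U *v v) $ i))\<^sup>2"
    proof
      fix i show "a i * (norm ((dagger U *v v) $ i))\<^sup>2 \<le> t * (norm ((dagger U *v v) $ i))\<^sup>2"
        using zA[of i] by (cases "t \<le> a i") (auto intro: mult_right_mono)
    qed
    \<comment> \<open>A nonzero coordinate of \<open>v\<close> supplies the strict inequality
      between the sums.\<close>
    have "a k < t" using k zA[of k] by force
    then show "\<exists>i\<in>UNIV. a i * (norm ((dagger U *v v) $ i))\<^sup>2 < t * (norm ((dagger U *v v) $ i))\<^sup>2"
      using k by (intro bexI[of _ k]) auto
  qed simp
  finally show False by simp
qed

lemma ordered_eigenvalues_prob:
  fixes \<rho> :: "complex^'n^'n"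
  assumes "\<rho> \<in> states"
  shows "ordered_eigenvalues \<rho> \<in> prob_vectors CARD('n)"
proof -
  obtain U a where "spectral_decomposition \<rho> U a" using hermitian_spectral[OF state_hermitian[OF assms]] .
  then interpret spectral_decomposition \<rho> U a .
  have "0 \<le> ordered_eigenvalues \<rho> ! i" if "i < CARD('n)" for i
  proof -
    have "ordered_eigenvalues \<rho> ! i \<in> range a"
      using nth_mem[of i "ordered_eigenvalues \<rho>"] that
      by (simp add: length_ordered_eigenvalues set_ordered_eigenvalues)
    then show ?thesis using state_psd[OF assms] psd_iff_eigenvalues by auto
  qed
  moreover have "(\<Sum>i\<in>UNIV. a i) = 1"
    using state_trace[OF assms] unfolding trace_eq by (simp only: of_real_eq_1_iff)
  ultimately show ?thesis
    by (simp add: prob_vectors_def length_ordered_eigenvalues sum_ordered_eigenvalues)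
qed

text \<open>Weyl monotonicity for the normalized states. A violation at position \<open>i\<close>
  would put \<open>CARD('n) - i\<close> eigenvalues of \<open>normalized \<rho>\<close> below the
  threshold \<open>t\<close> and \<open>i + 1\<close> eigenvalues of
  \<open>normalized \<sigma>\<close> at or above it, one more in total than the dimension count
  permits.\<close>

lemma qpe_ordered_eigenvalues:
  fixes \<rho> \<sigma> :: "complex^'n^'n"
  assumes "\<rho> \<sqsubseteq>\<^sub>Q \<sigma>"
  shows "qpe_vec CARD('n) (ordered_eigenvalues \<rho>) (ordered_eigenvalues \<sigma>)"
proof -
  from assms have st: "\<rho> \<in> states" "\<sigma> \<in> states" and le: "psd (normalized \<rho> - normalized \<sigma>)"
    by (auto simp: qpe_iff)
  obtain U a where "spectral_decomposition \<rho> U a" using hermitian_spectral[OF state_hermitian[OF st(1)]] .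
  then interpret A: spectral_decomposition \<rho> U a .
  obtain V b where "spectral_decomposition \<sigma> V b" using hermitian_spectral[OF state_hermitian[OF st(2)]] .
  then interpret B: spectral_decomposition \<sigma> V b .
  let ?x = "ordered_eigenvalues \<rho>" and ?y = "ordered_eigenvalues \<sigma>"
  let ?p = "top_eigenvalue \<rho>" and ?q = "top_eigenvalue \<sigma>"
  have pq: "?p > 0" "?q > 0" using st by (auto intro: state_top_pos)
  have "?y ! i / ?q \<le> ?x ! i / ?p" if i: "i < CARD('n)" for i
  proof (rule ccontr)
    define t where "t = ?y ! i / ?q"
    assume "\<not> ?thesis"
    then have less: "?x ! i / ?p < t" by (simp add: t_def)
    have "{i..<CARD('n)} \<subseteq> {j. j < CARD('n) \<and> ?x ! j / ?p < t}"
    proof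
      fix j assume "j \<in> {i..<CARD('n)}"
      then have j: "i \<le> j" "j < CARD('n)" by auto
      then have "?x ! j / ?p \<le> ?x ! i / ?p"
        using pq ordered_eigenvalues_antimono[of i j \<rho>]
        by (intro divide_right_mono) (auto simp: A.length_ordered_eigenvalues)
      with less j show "j \<in> {j. j < CARD('n) \<and> ?x ! j / ?p < t}" by simp
    qed
    from card_mono[OF _ this] have "CARD('n) - i \<le> card {j. a j / ?p < t}"
      unfolding A.length_filter_ordered_eigenvalues[symmetric, where P = "\<lambda>r. r / ?p < t"]
      by (simp add: length_filter_conv_card A.length_ordered_eigenvalues)
    \<comment> \<open>Position \<open>i\<close> itself is included, with equality; this gives the
      extra 1 that makes the counts contradictory.\<close>
    moreover have "{..i} \<subseteq> {j. j < CARD('n) \<and> t \<le> ?y ! j / ?q}"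
      using pq i ordered_eigenvalues_antimono[of _ i \<sigma>]
      by (auto simp: t_def B.length_ordered_eigenvalues intro!: divide_right_mono)
    from card_mono[OF _ this] have "Suc i \<le> card {j. t \<le> b j / ?q}"
      unfolding B.length_filter_ordered_eigenvalues[symmetric, where P = "\<lambda>r. t \<le> r / ?q"]
      by (simp add: length_filter_conv_card B.length_ordered_eigenvalues)
    moreover have "card {j. a j / ?p < t} + card {j. t \<le> b j / ?q} \<le> CARD('n)"
      using eigenvalue_count[OF A.spectral_decomposition_scaleR[of "1 / ?p"]
        B.spectral_decomposition_scaleR[of "1 / ?q"]] le
      by (simp add: normalized_def)
    ultimately show False using i by linarith
  qed
  then show ?thesis
    by (simp add: qpe_vec_def ordered_eigenvalues_prob st A.Max_ordered_eigenvalues B.Max_ordered_eigenvalues)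
qed

theorem theorem4:
  fixes \<rho> \<sigma> :: "complex^'n^'n"
  assumes "\<rho> \<in> states" and "\<sigma> \<in> states"
  shows
    "completely_mixed \<sqsubseteq>\<^sub>Q \<rho>
     \<and>
     (\<forall>v :: complex^'n. norm v = 1 \<longrightarrow>
        qpe_maximal (ketbra v) \<and> (\<rho> \<sqsubseteq>\<^sub>Q ketbra v \<longleftrightarrow> v \<in> top_eigenspace \<rho>))
     \<and>
     ((\<forall>U :: complex^'n^'n. unitary_mat U \<longrightarrow>
         (\<rho> \<sqsubseteq>\<^sub>Q \<sigma> \<longleftrightarrow> U ** \<rho> ** dagger U \<sqsubseteq>\<^sub>Q U ** \<sigma> ** dagger U)) \<and>
      (\<forall>\<Phi> :: complex^'n^'n \<Rightarrow> complex^'k^'k.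
         Vector_Spaces.linear cscale cscale \<Phi> \<longrightarrow>
         (\<forall>A. op_norm (\<Phi> A) = op_norm A) \<longrightarrow>
         (\<forall>A. trace (\<Phi> A) = trace A) \<longrightarrow>
         \<Phi> ` states \<subseteq> states \<longrightarrow>
         (\<rho> \<sqsubseteq>\<^sub>Q \<sigma> \<longleftrightarrow> \<Phi> \<rho> \<sqsubseteq>\<^sub>Q \<Phi> \<sigma>)))
     \<and>
     (\<rho> \<sqsubseteq>\<^sub>Q \<sigma> \<longrightarrow> mat_ker \<rho> \<subseteq> mat_ker \<sigma> \<and> rank \<rho> \<ge> rank \<sigma>)
     \<and>
     (\<rho> \<sqsubseteq>\<^sub>Q \<sigma> \<longleftrightarrow>
        (\<forall>t::real. 0 \<le> t \<and> t \<le> 1 \<longrightarrow>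
           \<rho> \<sqsubseteq>\<^sub>Q (1 - t) *\<^sub>R \<rho> + t *\<^sub>R \<sigma> \<and> (1 - t) *\<^sub>R \<rho> + t *\<^sub>R \<sigma> \<sqsubseteq>\<^sub>Q \<sigma>))
     \<and>
     ((closedin (top_of_set states) {\<rho>' \<in> states. \<rho>' \<sqsubseteq>\<^sub>Q \<sigma>} \<and> convex {\<rho>' \<in> states. \<rho>' \<sqsubseteq>\<^sub>Q \<sigma>}) \<and>
      closedin (top_of_set states) {\<sigma>' \<in> states. \<rho> \<sqsubseteq>\<^sub>Q \<sigma>'} \<and>
      (\<exists>\<C>. (\<forall>C\<in>\<C>. closedin (top_of_set states) C \<and> convex C) \<and> {\<sigma>' \<in> states. \<rho> \<sqsubseteq>\<^sub>Q \<sigma>'} = \<Union>\<C>) \<and>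
      pospace_on states {(\<alpha> :: complex^'n^'n, \<beta>). \<alpha> \<sqsubseteq>\<^sub>Q \<beta>})
     \<and>
     (\<forall>(\<rho>1 :: complex^'a^'a) \<sigma>1 (\<rho>2 :: complex^'b^'b) \<sigma>2.
        \<rho>1 \<sqsubseteq>\<^sub>Q \<sigma>1 \<and> \<rho>2 \<sqsubseteq>\<^sub>Q \<sigma>2 \<longrightarrow> \<rho>1 \<otimes>\<^sub>Q \<rho>2 \<sqsubseteq>\<^sub>Q \<sigma>1 \<otimes>\<^sub>Q \<sigma>2)
     \<and>
     (\<rho> \<sqsubseteq>\<^sub>Q \<sigma> \<longrightarrow> qpe_vec CARD('n) (ordered_eigenvalues \<rho>) (ordered_eigenvalues \<sigma>))"
proof (intro conjI allI impI)
  note st = assms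
  show "completely_mixed \<sqsubseteq>\<^sub>Q \<rho>" using st(1) by (rule completely_mixed_bottom)
  show "qpe_maximal (ketbra v)" if "norm v = 1" for v :: "complex^'n"
    using that by (rule ketbra_maximal)
  show "\<rho> \<sqsubseteq>\<^sub>Q ketbra v \<longleftrightarrow> v \<in> top_eigenspace \<rho>" if "norm v = 1" for v
    using st(1) that by (rule qpe_ketbra_iff)
  show "\<rho> \<sqsubseteq>\<^sub>Q \<sigma> \<longleftrightarrow> U ** \<rho> ** dagger U \<sqsubseteq>\<^sub>Q U ** \<sigma> ** dagger U" if "unitary_mat U" for U
    using that st by (rule qpe_unitary_conj_iff)
  show "\<rho> \<sqsubseteq>\<^sub>Q \<sigma> \<longleftrightarrow> \<Phi> \<rho> \<sqsubseteq>\<^sub>Q \<Phi> \<sigma>"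
    if "Vector_Spaces.linear cscale cscale \<Phi>" "\<forall>A. op_norm (\<Phi> A) = op_norm A" "\<Phi> ` states \<subseteq> states"
    for \<Phi> :: "complex^'n^'n \<Rightarrow> complex^'k^'k"
  proof -
    interpret state_isometry \<Phi> using that by (auto simp: state_isometry_def)
    show ?thesis using st by (rule qpe_image_iff)
  qed
  show "mat_ker \<rho> \<subseteq> mat_ker \<sigma>" if "\<rho> \<sqsubseteq>\<^sub>Q \<sigma>"
    using that by (rule qpe_ker)
  show "rank \<rho> \<ge> rank \<sigma>" if "\<rho> \<sqsubseteq>\<^sub>Q \<sigma>"
    using state_hermitian[OF st(1)] qpe_ker[OF that] by (rule hermitian_ker_rank)
  show "\<rho> \<sqsubseteq>\<^sub>Q \<sigma> \<longleftrightarrow> (\<forall>t::real. 0 \<le> t \<and> t \<le> 1 \<longrightarrow>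
      \<rho> \<sqsubseteq>\<^sub>Q (1 - t) *\<^sub>R \<rho> + t *\<^sub>R \<sigma> \<and> (1 - t) *\<^sub>R \<rho> + t *\<^sub>R \<sigma> \<sqsubseteq>\<^sub>Q \<sigma>)" (is "_ \<longleftrightarrow> ?R")
  proof
    assume ?R
    \<comment> \<open>At the endpoint \<open>t = 1\<close> the mixture is
      \<open>\<sigma>\<close>.\<close>
    then show "\<rho> \<sqsubseteq>\<^sub>Q \<sigma>" by (auto dest: spec[of _ 1])
  qed (auto intro: qpe_convex)
  show "closedin (top_of_set states) {\<rho>' \<in> states. \<rho>' \<sqsubseteq>\<^sub>Q \<sigma>}"
    using closedin_section(2)[OF closed_qpe_graph st(2)] by simp
  show "convex {\<rho>' \<in> states. \<rho>' \<sqsubseteq>\<^sub>Q \<sigma>}" by (rule convex_downset)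
  show "closedin (top_of_set states) {\<sigma>' \<in> states. \<rho> \<sqsubseteq>\<^sub>Q \<sigma>'}"
    using closedin_section(1)[OF closed_qpe_graph st(1)] by simp
  show "\<exists>\<C>. (\<forall>C\<in>\<C>. closedin (top_of_set states) C \<and> convex C) \<and> {\<sigma>' \<in> states. \<rho> \<sqsubseteq>\<^sub>Q \<sigma>'} = \<Union>\<C>"
  proof (intro exI conjI ballI)
    \<comment> \<open>Each element of the upset is an endpoint of its own segment, so the segments
      cover it, and none leaves it.\<close>
    let ?\<C> = "closed_segment \<rho> ` {\<sigma>' \<in> states. \<rho> \<sqsubseteq>\<^sub>Q \<sigma>'}"
    show "closedin (top_of_set states) C" "convex C" if "C \<in> ?\<C>" for C
      using that segment_subset_upset[of \<rho>] by (force intro: closed_subset)+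
    show "{\<sigma>' \<in> states. \<rho> \<sqsubseteq>\<^sub>Q \<sigma>'} = \<Union>?\<C>"
      using segment_subset_upset[of \<rho>] by fastforce
  qed
  show "pospace_on states {(\<alpha> :: complex^'n^'n, \<beta>). \<alpha> \<sqsubseteq>\<^sub>Q \<beta>}" by (rule pospace_qpe)
  show "\<rho>1 \<otimes>\<^sub>Q \<rho>2 \<sqsubseteq>\<^sub>Q \<sigma>1 \<otimes>\<^sub>Q \<sigma>2" if "\<rho>1 \<sqsubseteq>\<^sub>Q \<sigma>1 \<and> \<rho>2 \<sqsubseteq>\<^sub>Q \<sigma>2"
    for \<rho>1 \<sigma>1 :: "complex^'a^'a" and \<rho>2 \<sigma>2 :: "complex^'b^'b"
    using that by (auto intro: qpe_tensor)
  show "qpe_vec CARD('n) (ordered_eigenvalues \<rho>) (ordered_eigenvalues \<sigma>)" if "\<rho> \<sqsubseteq>\<^sub>Q \<sigma>"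
    using that by (rule qpe_ordered_eigenvalues)
qed

end
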